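(* Let $\alpha\in(0,1)$ be an irrational number which is not of bounded type. For $\beta\in[0,1)$ let $\varphi(\beta,\cdot)=1_{[0,\beta[}-\beta$ on $\mathbb{T}^1$. There exists a sequence $(q_{t_k})_{k\ge1}$ of denominators of $\alpha$ (with $(t_k)$ strictly increasing) such that, for the subsequence $L_N=q_{t_1}+\dots+q_{t_N}$, for Lebesgue-a.e. $\beta$, $$\frac{\sqrt6}{\sqrt N}\sum_{j=1}^{L_N}\varphi(\beta,\,\cdot+j\alpha)\ \longrightarrow\ \mathcal N(0,1)\quad\text{in distribution as } N\to\infty .$$
   Context: $\alpha=[0;a_1,a_2,\dots]$ is the continued fraction expansion; the denominators $q_n$ of the convergents satisfy $q_{-1}=0$, $q_0=1$, $q_{n+1}=a_{n+1}q_n+q_{n-1}$. "Bounded type" (constant type) means $\sup_k a_k<\infty$. $\mathbb{T}^1=\mathbb{R}/\mathbb{Z}$ is identified with $[0,1)$, arguments of functions are taken modulo $1$, and convergence in distribution is with respect to Lebesgue measure on $\mathbb{T}^1$ in the variable $x$ (written as a dot). *)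

theory Defs
  imports "HOL-Probability.Probability"
begin

text \<open>
  Regular continued fraction expansion of an irrational \<open>\<alpha>\<close> in \<open>(0,1)\<close>, via the complete
  quotients \<open>\<alpha> = [0; a\<^sub>1, ..., a\<^sub>n\<^sub>-\<^sub>1, \<zeta>\<^sub>n]\<close>. The zeroth partial quotient is \<open>\<lfloor>\<alpha>\<rfloor> = 0\<close>; the
  partial quotients \<open>a\<^sub>1, a\<^sub>2, ...\<close> are the values at indices at least \<open>1\<close>.
\<close>

fun complete_quotient :: "real \<Rightarrow> nat \<Rightarrow> real" where
  "complete_quotient \<alpha> 0 = \<alpha>"
| "complete_quotient \<alpha> (Suc n) = 1 / frac (complete_quotient \<alpha> n)"

definition partial_quotient :: "real \<Rightarrow> nat \<Rightarrow> nat" where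
  "partial_quotient \<alpha> n = nat \<lfloor>complete_quotient \<alpha> n\<rfloor>"

text \<open>The convention \<open>q\<^sub>-\<^sub>1 = 0\<close> is absorbed into the equation for index \<open>1\<close>.\<close>

fun cf_denom :: "real \<Rightarrow> nat \<Rightarrow> nat" where
  "cf_denom \<alpha> 0 = 1"
| "cf_denom \<alpha> (Suc 0) = partial_quotient \<alpha> 1"
| "cf_denom \<alpha> (Suc (Suc n)) =
     partial_quotient \<alpha> (Suc (Suc n)) * cf_denom \<alpha> (Suc n) + cf_denom \<alpha> n"

definition bounded_type :: "real \<Rightarrow> bool" where
  "bounded_type \<alpha> \<longleftrightarrow> bdd_above (partial_quotient \<alpha> ` {1..})"

text \<open>Lebesgue measure on the circle \<open>\<real>/\<int>\<close>, identified with \<open>[0,1)\<close>.\<close>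

definition circle_measure :: "real measure" where
  "circle_measure = restrict_space lborel {0..<1}"

text \<open>The argument \<open>x\<close> is an arbitrary real, reduced modulo \<open>1\<close>.\<close>

definition centred_indicator :: "real \<Rightarrow> real \<Rightarrow> real" where
  "centred_indicator \<beta> x = indicator {0..<\<beta>} (frac x) - \<beta>"

end

theory Submission
  imports Defs
begin

text \<open>
  Let \<open>\<phi>\<^sub>\<beta>\<close> be the centred indicator of \<open>[0, \<beta>)\<close>. If \<open>p / q\<close> is a convergent of \<open>\<alpha>\<close> followed by a large
  partial quotient \<open>a\<close>, the orbit of length \<open>q\<close> under rotation by \<open>\<alpha>\<close> is very close to a coset of the
  subgroup of order \<open>q\<close>, and a sum of \<open>\<phi>\<^sub>\<beta>\<close> over such a coset is \<open>\<phi>\<^sub>b (q x)\<close> with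
  \<open>b = frac (q \<beta>)\<close> (Hermite's identity). The error is at most \<open>2 / a\<close> in mean
  (\<open>L1_block_approximation\<close>, \<open>convergent_approximation\<close>). As \<open>\<alpha>\<close> is not of bounded type, the
  denominators \<open>q\<^sub>k\<close> can be chosen such that these errors are summable and \<open>q\<^sub>k\<close> grows much
  faster than the sum of its predecessors (\<open>sparse_denominators\<close>). The Birkhoff sum of length
  \<open>L\<^sub>N\<close>, cut into blocks of these lengths, then becomes a lacunary sum
  \<open>\<Sum>k<N. \<phi>\<^sub>b\<^sub>k (q\<^sub>k x + c\<^sub>k)\<close> up to an error bounded in mean.

  Such a sum behaves like a sum of independent variables: a function of \<open>q\<^sub>k x\<close> is almost
  uncorrelated with everything that varies on the scale of the earlier frequencies. This is the
  lemma \<open>mixing\<close>, used twice. In the variable \<open>x\<close>, it shows that the characteristic function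
  of the sum is close to the product of those of the summands
  (\<open>product_of_dilates\<close>, \<open>char_sum_of_dilates\<close>). In the variable \<open>\<beta>\<close>, it bounds the second moments of
  the sums of \<open>b\<^sub>k (1 - b\<^sub>k) - 1 / 6\<close>, and hence, for almost every \<open>\<beta>\<close>, the variances
  \<open>b\<^sub>k (1 - b\<^sub>k)\<close> have averages tending to \<open>1 / 6\<close>, the integral of \<open>y (1 - y)\<close> over the unit interval
  (\<open>AE_average_variance\<close>). After multiplication by \<open>sqrt 6 / sqrt N\<close> the characteristic functions
  converge to the Gaussian one (\<open>central_limit_blocks\<close>).
\<close>

section \<open>Rational approximation by convergents\<close>

fun cf_num :: "real \<Rightarrow> nat \<Rightarrow> nat" where
  "cf_num \<alpha> 0 = 0"
| "cf_num \<alpha> (Suc 0) = 1"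
| "cf_num \<alpha> (Suc (Suc n)) =
     partial_quotient \<alpha> (Suc (Suc n)) * cf_num \<alpha> (Suc n) + cf_num \<alpha> n"

lemma complete_quotient_irrational:
  assumes "\<alpha> \<notin> \<rat>"
  shows "complete_quotient \<alpha> n \<notin> \<rat>"
proof (induction n)
  case 0
  then show ?case using assms by simp
next
  case (Suc n)
  show ?case
  proof
    assume "complete_quotient \<alpha> (Suc n) \<in> \<rat>"
    then have "1 / complete_quotient \<alpha> (Suc n) \<in> \<rat>"
      by (intro Rats_divide) auto
    then have "frac (complete_quotient \<alpha> n) \<in> \<rat>" by simp
    then have "frac (complete_quotient \<alpha> n) + of_int \<lfloor>complete_quotient \<alpha> n\<rfloor> \<in> \<rat>"
      by (intro Rats_add) auto
    then show False using Suc by (simp add: frac_def)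
  qed
qed

lemma frac_complete_quotient_pos:
  assumes "\<alpha> \<notin> \<rat>"
  shows "0 < frac (complete_quotient \<alpha> n)"
  using complete_quotient_irrational[OF assms, of n] frac_ge_0[of "complete_quotient \<alpha> n"]
    frac_eq_0_iff[of "complete_quotient \<alpha> n"] Ints_subset_Rats
  by (metis less_eq_real_def subsetD)

lemma complete_quotient_gt_1:
  assumes "\<alpha> \<notin> \<rat>"
  shows "1 < complete_quotient \<alpha> (Suc n)"
  using frac_complete_quotient_pos[OF assms, of n] frac_lt_1[of "complete_quotient \<alpha> n"]
  by simp

lemma partial_quotient_pos:
  assumes "\<alpha> \<notin> \<rat>"
  shows "1 \<le> partial_quotient \<alpha> (Suc n)"
proof -
  have "1 \<le> \<lfloor>complete_quotient \<alpha> (Suc n)\<rfloor>"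
    using complete_quotient_gt_1[OF assms, of n] by linarith
  then show ?thesis unfolding partial_quotient_def by linarith
qed

lemma complete_quotient_eq:
  assumes "\<alpha> \<notin> \<rat>"
  shows "complete_quotient \<alpha> (Suc n) =
    partial_quotient \<alpha> (Suc n) + 1 / complete_quotient \<alpha> (Suc (Suc n))"
proof -
  have "0 \<le> \<lfloor>complete_quotient \<alpha> (Suc n)\<rfloor>"
    using complete_quotient_gt_1[OF assms, of n] by linarith
  then have "real (partial_quotient \<alpha> (Suc n)) = of_int \<lfloor>complete_quotient \<alpha> (Suc n)\<rfloor>"
    unfolding partial_quotient_def by simp
  then show ?thesis by (simp add: frac_def)
qed

text \<open>
  The formula \<open>\<alpha> = (\<zeta>\<^sub>n\<^sub>+\<^sub>1 p\<^sub>n + p\<^sub>n\<^sub>-\<^sub>1) / (\<zeta>\<^sub>n\<^sub>+\<^sub>1 q\<^sub>n + q\<^sub>n\<^sub>-\<^sub>1)\<close> in a form without division. It turns the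
  determinant identity into an exact expression for the approximation error.
\<close>

lemma cf_tail:
  assumes "\<alpha> \<notin> \<rat>" "0 < \<alpha>" "\<alpha> < 1"
  shows "\<alpha> * (complete_quotient \<alpha> (Suc (Suc n)) * cf_denom \<alpha> (Suc n) + cf_denom \<alpha> n) =
    complete_quotient \<alpha> (Suc (Suc n)) * cf_num \<alpha> (Suc n) + cf_num \<alpha> n"
proof (induction n)
  case 0
  define z where "z = complete_quotient \<alpha> (Suc (Suc 0))"
  have z: "1 < z" unfolding z_def by (rule complete_quotient_gt_1[OF assms(1)])
  have "complete_quotient \<alpha> (Suc 0) = 1 / \<alpha>"
    using assms by (simp add: frac_eq)
  then have "1 / \<alpha> = partial_quotient \<alpha> (Suc 0) + 1 / z"
    using complete_quotient_eq[OF assms(1), of 0] z_def by simp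
  then have "\<alpha> * (z * partial_quotient \<alpha> (Suc 0) + 1) = z"
    using z assms(2) by (simp add: field_simps)
  then show ?case
    unfolding z_def[symmetric] by simp
next
  case (Suc n)
  define z where "z = complete_quotient \<alpha> (Suc (Suc (Suc n)))"
  have z: "1 < z" unfolding z_def by (rule complete_quotient_gt_1[OF assms(1)])
  let ?a = "real (partial_quotient \<alpha> (Suc (Suc n)))"
  have eq: "complete_quotient \<alpha> (Suc (Suc n)) = ?a + 1 / z"
    using complete_quotient_eq[OF assms(1), of "Suc n"] z_def by simp
  have clear: "z * ((?a + 1 / z) * x + y) = z * (?a * x + y) + x" for x y :: real
    using z by (simp add: field_simps)
  have "\<alpha> * (z * ((?a + 1 / z) * cf_denom \<alpha> (Suc n) + cf_denom \<alpha> n)) =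
    z * ((?a + 1 / z) * cf_num \<alpha> (Suc n) + cf_num \<alpha> n)"
    using Suc.IH unfolding eq by (simp add: mult.left_commute)
  then have "\<alpha> * (z * (?a * cf_denom \<alpha> (Suc n) + cf_denom \<alpha> n) + cf_denom \<alpha> (Suc n)) =
    z * (?a * cf_num \<alpha> (Suc n) + cf_num \<alpha> n) + cf_num \<alpha> (Suc n)"
    unfolding clear .
  then show ?case
    unfolding z_def[symmetric] by simp
qed

lemma cf_determinant:
  "int (cf_num \<alpha> (Suc n)) * cf_denom \<alpha> n - int (cf_num \<alpha> n) * cf_denom \<alpha> (Suc n) = (-1) ^ n"
  by (induction n) (simp_all add: algebra_simps)

lemma cf_denom_ge_1:
  assumes "\<alpha> \<notin> \<rat>"
  shows "1 \<le> cf_denom \<alpha> n"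
proof (induction n rule: less_induct)
  case (less n)
  show ?case
  proof (cases n)
    case (Suc m)
    then show ?thesis using partial_quotient_pos[OF assms] less[of "m - 1"]
      by (cases m) (auto simp: trans_le_add2)
  qed simp
qed

lemma cf_denom_Suc_Suc:
  assumes "\<alpha> \<notin> \<rat>"
  shows "cf_denom \<alpha> (Suc n) + 1 \<le> cf_denom \<alpha> (Suc (Suc n))"
proof -
  have "1 * cf_denom \<alpha> (Suc n) \<le> partial_quotient \<alpha> (Suc (Suc n)) * cf_denom \<alpha> (Suc n)"
    using partial_quotient_pos[OF assms] by (intro mult_right_mono) auto
  then show ?thesis using cf_denom_ge_1[OF assms, of n] unfolding cf_denom.simps(3) by linarith
qed

lemma cf_denom_mono:
  assumes "\<alpha> \<notin> \<rat>"
  shows "mono (cf_denom \<alpha>)"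
proof (rule mono_iff_le_Suc[THEN iffD2], rule allI)
  fix n show "cf_denom \<alpha> n \<le> cf_denom \<alpha> (Suc n)"
    using cf_denom_Suc_Suc[OF assms, of "n - 1"] cf_denom_ge_1[OF assms, of "Suc 0"]
    by (cases n) (auto simp del: cf_denom.simps(2,3))
qed

lemma cf_denom_ge_index:
  assumes "\<alpha> \<notin> \<rat>"
  shows "n \<le> cf_denom \<alpha> n"
proof (induction n)
  case (Suc n)
  then show ?case
    using cf_denom_Suc_Suc[OF assms, of "n - 1"] cf_denom_ge_1[OF assms, of "Suc 0"]
    by (cases n) (auto simp del: cf_denom.simps(2,3))
qed simp

text \<open>
  Multiplying \<open>q \<alpha> - p\<close> by \<open>\<zeta> q + q'\<close>, where \<open>q'\<close> is the preceding denominator and \<open>\<zeta>\<close> the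
  next complete quotient, gives the determinant \<open>\<plusminus>1\<close>. So a large next partial quotient makes
  the rotation by \<open>\<alpha>\<close> almost periodic with period \<open>q\<close>.
\<close>

lemma convergent_approximation:
  fixes \<alpha> :: real
  assumes "\<alpha> \<notin> \<rat>" "0 < \<alpha>" "\<alpha> < 1"
  obtains p :: int where "coprime p (int (cf_denom \<alpha> (Suc n)))"
    "partial_quotient \<alpha> (Suc (Suc n)) *
       (cf_denom \<alpha> (Suc n) * \<bar>cf_denom \<alpha> (Suc n) * \<alpha> - p\<bar>) \<le> 1"
proof
  define p q p' q' z a where "p = cf_num \<alpha> (Suc n)" and "q = cf_denom \<alpha> (Suc n)"
    and "p' = cf_num \<alpha> n" and "q' = cf_denom \<alpha> n"
    and "z = complete_quotient \<alpha> (Suc (Suc n))"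
    and "a = partial_quotient \<alpha> (Suc (Suc n))"
  have det: "int p * q' - int p' * q = (-1) ^ n"
    unfolding p_def q_def p'_def q'_def by (rule cf_determinant)
  show "coprime (int p) (int (cf_denom \<alpha> (Suc n)))"
    unfolding q_def[symmetric]
  proof (rule coprimeI)
    fix d assume "d dvd int p" "d dvd int q"
    then have "d dvd int p * q' - int p' * q" by (intro dvd_diff dvd_mult2 dvd_mult)
    then have "d dvd (-1) ^ n" unfolding det .
    then show "is_unit d" by (metis dvd_trans minus_one_power_iff dvd_minus_iff one_dvd dvd_refl)
  qed
  have tail: "\<alpha> * (z * q + q') = z * p + p'"
    using cf_tail[OF assms, of n] unfolding z_def p_def q_def p'_def q'_def .
  have az: "a \<le> z" "0 < z"
    using complete_quotient_gt_1[OF assms(1), of "Suc n"]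
    unfolding a_def z_def partial_quotient_def by (auto simp del: complete_quotient.simps)
  have "(q * \<alpha> - p) * (z * q + q') = q * (\<alpha> * (z * q + q')) - p * (z * q + q')"
    by (simp add: algebra_simps)
  also have "\<dots> = of_int (- (int p * q' - int p' * q))"
    unfolding tail by (simp add: algebra_simps)
  finally have "\<bar>(q * \<alpha> - p) * (z * q + q')\<bar> = 1"
    unfolding det by simp
  then have "\<bar>q * \<alpha> - p\<bar> * (z * q + q') = 1"
    using az by (simp add: abs_mult)
  moreover have "\<bar>q * \<alpha> - p\<bar> * (a * q) \<le> \<bar>q * \<alpha> - p\<bar> * (z * q + q')"
    using az by (intro mult_left_mono) (auto intro!: add_increasing2 mult_right_mono)
  ultimately show "partial_quotient \<alpha> (Suc (Suc n)) *
       (cf_denom \<alpha> (Suc n) * \<bar>cf_denom \<alpha> (Suc n) * \<alpha> - (int p)\<bar>) \<le> 1"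
    unfolding q_def[symmetric] a_def[symmetric] by (simp add: mult_ac)
qed

section \<open>Integration over the circle\<close>

lemma space_circle [simp]: "space circle_measure = {0..<1}"
  unfolding circle_measure_def by simp

lemma prob_space_circle: "prob_space circle_measure"
  by (rule prob_spaceI) (simp add: circle_measure_def emeasure_restrict_space)

interpretation circle: prob_space circle_measure
  by (rule prob_space_circle)

lemma measurable_circle [measurable (raw)]:
  "f \<in> borel_measurable borel \<Longrightarrow> f \<in> borel_measurable circle_measure"
  unfolding circle_measure_def by (intro measurable_restrict_space1) simp

lemma borel_measurable_frac [measurable (raw)]:
  fixes f :: "'a \<Rightarrow> real"
  shows "f \<in> borel_measurable M \<Longrightarrow> (\<lambda>x. frac (f x)) \<in> borel_measurable M"
  using measurable_compose[OF _ borel_measurable_real_floor, of f M]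
  unfolding frac_def by simp

lemma borel_measurable_centred_indicator [measurable (raw)]:
  "f \<in> borel_measurable M \<Longrightarrow> (\<lambda>x. centred_indicator \<beta> (f x)) \<in> borel_measurable M"
  unfolding centred_indicator_def by (intro borel_measurable_diff; measurable)

text \<open>
  Functions on \<open>\<real>/\<int>\<close> are represented by periodic functions on the line. Boundedness is
  included so that integrability and Fubini need no further hypotheses.
\<close>

definition circle_fun :: "(real \<Rightarrow> 'a::real_normed_vector) \<Rightarrow> bool" where
  "circle_fun f \<longleftrightarrow> f \<in> borel_measurable borel \<and> bounded (range f) \<and> (\<forall>x. f (x + 1) = f x)"

lemma circle_funI:
  assumes "f \<in> borel_measurable borel" "\<And>x. norm (f x) \<le> C" "\<And>x. f (x + 1) = f x"
  shows "circle_fun f"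
  using assms unfolding circle_fun_def bounded_iff by auto

lemma circle_fun_measurable [measurable_dest]: "circle_fun f \<Longrightarrow> f \<in> borel_measurable borel"
  and circle_fun_add_one: "circle_fun f \<Longrightarrow> f (x + 1) = f x"
  unfolding circle_fun_def by auto

lemma circle_fun_bound:
  assumes "circle_fun f"
  obtains C where "\<And>x. norm (f x) \<le> C"
  using assms unfolding circle_fun_def bounded_iff by auto

lemma circle_fun_add_int:
  assumes "circle_fun f"
  shows "f (x + of_int n) = f x"
proof (induction n arbitrary: x rule: int_induct[where k = 0])
  case (step1 i)
  have "f (x + of_int (i + 1)) = f ((x + of_int i) + 1)" by (simp add: algebra_simps)
  then show ?case using step1 circle_fun_add_one[OF assms] by simp
next
  case (step2 i)
  have "f (x + of_int i) = f ((x + of_int (i - 1)) + 1)" by (simp add: algebra_simps)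
  then show ?case using step2 circle_fun_add_one[OF assms, of "x + of_int (i - 1)"] by simp
qed simp

lemma circle_fun_shift:
  assumes "circle_fun f"
  shows "circle_fun (\<lambda>x. f (of_nat q * x + c))"
proof -
  obtain C where C: "\<And>x. norm (f x) \<le> C" by (rule circle_fun_bound[OF assms]) blast
  have "f (of_nat q * (x + 1) + c) = f (of_nat q * x + c)" for x
    using circle_fun_add_int[OF assms, of "of_nat q * x + c" "int q"]
    by (simp add: algebra_simps)
  then show ?thesis
    using C circle_fun_measurable[OF assms] by (intro circle_funI[of _ C]) auto
qed

lemma circle_fun_const: "circle_fun (\<lambda>_. c)"
  by (rule circle_funI[of _ "norm c"]) auto

lemma circle_fun_add:
  fixes f g :: "real \<Rightarrow> 'a::{banach, second_countable_topology}"
  assumes f: "circle_fun f" and g: "circle_fun g"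
  shows "circle_fun (\<lambda>x. f x + g x)"
proof -
  obtain C where C: "\<And>x. norm (f x) \<le> C" by (rule circle_fun_bound[OF f]) blast
  obtain D where D: "\<And>x. norm (g x) \<le> D" by (rule circle_fun_bound[OF g]) blast
  note [measurable] = circle_fun_measurable[OF f] circle_fun_measurable[OF g]
  show ?thesis
    by (rule circle_funI[OF _ norm_triangle_mono[OF C D]])
       (auto simp: circle_fun_add_one[OF f] circle_fun_add_one[OF g])
qed

lemma circle_fun_mult:
  fixes f g :: "real \<Rightarrow> 'a::{real_normed_field, banach, second_countable_topology}"
  assumes f: "circle_fun f" and g: "circle_fun g"
  shows "circle_fun (\<lambda>x. f x * g x)"
proof -
  obtain C where C: "\<And>x. norm (f x) \<le> C" by (rule circle_fun_bound[OF f]) blast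
  obtain D where D: "\<And>x. norm (g x) \<le> D" by (rule circle_fun_bound[OF g]) blast
  note [measurable] = circle_fun_measurable[OF f] circle_fun_measurable[OF g]
  have "norm (f x * g x) \<le> C * D" for x
    unfolding norm_mult by (intro mult_mono C D) (auto intro: order_trans[OF norm_ge_zero C])
  then show ?thesis
    by (rule circle_funI[rotated]) (auto simp: circle_fun_add_one[OF f] circle_fun_add_one[OF g])
qed

lemma integrable_circle_bounded:
  fixes f :: "real \<Rightarrow> 'a::{banach, second_countable_topology}"
  assumes "f \<in> borel_measurable borel" "\<And>x. norm (f x) \<le> C"
  shows "integrable circle_measure f"
  using assms by (intro circle.integrable_const_bound[of _ C]) (auto intro: measurable_circle)

lemma integrable_circle_fun:
  fixes f :: "real \<Rightarrow> 'a::{banach, second_countable_topology}"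
  assumes "circle_fun f"
  shows "integrable circle_measure f"
  using circle_fun_bound[OF assms] integrable_circle_bounded[of f] circle_fun_measurable[OF assms]
  by metis

lemma integral_circle:
  fixes f :: "real \<Rightarrow> 'a::{banach, second_countable_topology}"
  shows "integral\<^sup>L circle_measure f = (\<integral>x. indicator {0..<1} x *\<^sub>R f x \<partial>lborel)"
  unfolding circle_measure_def by (subst integral_restrict_space) auto

lemma integrable_interval_bounded:
  fixes f :: "real \<Rightarrow> 'a::{banach, second_countable_topology}"
  assumes "f \<in> borel_measurable borel" "\<And>x. norm (f x) \<le> C"
  shows "integrable lborel (\<lambda>x. indicator {a..<b::real} x *\<^sub>R f x)"
proof (rule Bochner_Integration.integrable_bound)
  show "integrable lborel (\<lambda>x. C * indicator {a..<b} x)"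
    by (intro integrable_mult_right integrable_real_indicator)
       (auto intro: le_less_trans[OF emeasure_mono[of _ "{a..b}"]] simp: emeasure_lborel_Icc_eq)
  show "(\<lambda>x. indicator {a..<b} x *\<^sub>R f x) \<in> borel_measurable lborel"
    using assms(1) by measurable
  show "AE x in lborel. norm (indicator {a..<b} x *\<^sub>R f x) \<le> norm (C * indicator {a..<b} x)"
    using assms(2) by (intro AE_I2) (auto simp: indicator_def intro: order_trans[OF _ abs_ge_self])
qed

text \<open>
  Translation invariance carries all later changes of variable: the dilations
  \<open>x \<mapsto> q x\<close> are reduced to it by averaging over the translations \<open>x \<mapsto> x + y / q\<close>.
\<close>

lemma integral_circle_translate:
  fixes f :: "real \<Rightarrow> 'a::{banach, second_countable_topology}"
  assumes f: "circle_fun f"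
  shows "(\<integral>x. f (x + c) \<partial>circle_measure) = (\<integral>x. f x \<partial>circle_measure)"
proof -
  define d where "d = frac c"
  have d: "0 \<le> d" "d < 1" unfolding d_def by (auto simp: frac_lt_1)
  obtain C where C: "\<And>x. norm (f x) \<le> C" by (rule circle_fun_bound[OF f]) blast
  let ?I = "\<lambda>a b. \<integral>x. indicator {a..<b} x *\<^sub>R f x \<partial>lborel"
  have int: "integrable lborel (\<lambda>x. indicator {a..<b} x *\<^sub>R f x)" for a b :: real
    using circle_fun_measurable[OF f] C by (rule integrable_interval_bounded)
  have split: "?I a c = ?I a b + ?I b c" if "a \<le> b" "b \<le> c" for a b c
    using that
    by (subst Bochner_Integration.integral_add[symmetric, OF int int])
       (auto intro!: Bochner_Integration.integral_cong simp: indicator_def)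
  have shift: "(\<integral>x. indicator {a..<b} x *\<^sub>R f (x + e) \<partial>lborel) = ?I (a + e) (b + e)" for a b e :: real
    by (subst lborel_integral_real_affine[of 1 _ e])
       (auto intro!: Bochner_Integration.integral_cong simp: indicator_def add.commute)
  have "f (x + c) = f (x + d)" for x
    using circle_fun_add_int[OF f, of "x + d" "\<lfloor>c\<rfloor>"] unfolding d_def frac_def by simp
  then have "(\<integral>x. f (x + c) \<partial>circle_measure) = ?I d (1 + d)"
    unfolding integral_circle using shift[of 0 1 d] by simp
  also have "\<dots> = ?I d 1 + ?I (0 + 1) (d + 1)"
    using split[of d 1 "1 + d"] d by (simp add: add.commute)
  also have "?I (0 + 1) (d + 1) = ?I 0 d"
    unfolding shift[symmetric] circle_fun_add_one[OF f] ..
  also have "?I d 1 + ?I 0 d = ?I 0 1"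
    using split[of 0 d 1] d by (simp add: add.commute)
  finally show ?thesis unfolding integral_circle .
qed

lemma integral_circle_swap:
  fixes f :: "real \<Rightarrow> real \<Rightarrow> 'a::{banach, second_countable_topology}"
  assumes [measurable]: "case_prod f \<in> borel_measurable (borel \<Otimes>\<^sub>M borel)"
    and "\<And>x y. norm (f x y) \<le> C"
  shows "integrable (circle_measure \<Otimes>\<^sub>M circle_measure) (case_prod f)"
    and "(\<integral>x. \<integral>y. f x y \<partial>circle_measure \<partial>circle_measure) =
      (\<integral>y. \<integral>x. f x y \<partial>circle_measure \<partial>circle_measure)"
proof -
  interpret P: pair_prob_space circle_measure circle_measure
    by unfold_locales
  have sets: "sets circle_measure = sets (restrict_space borel {0..<1::real})"
    unfolding circle_measure_def by (simp add: sets_restrict_space)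
  have id: "(\<lambda>x. x) \<in> circle_measure \<rightarrow>\<^sub>M borel"
    unfolding circle_measure_def by (intro measurable_restrict_space1) simp
  have "(\<lambda>z. case_prod f ((\<lambda>x. x) (fst z), (\<lambda>x. x) (snd z)))
      \<in> borel_measurable (circle_measure \<Otimes>\<^sub>M circle_measure)"
    by (rule measurable_compose[OF _ assms(1)])
       (intro measurable_Pair measurable_compose[OF measurable_fst id]
          measurable_compose[OF measurable_snd id])
  then have "case_prod f \<in> borel_measurable (circle_measure \<Otimes>\<^sub>M circle_measure)"
    by simp
  then show *: "integrable (circle_measure \<Otimes>\<^sub>M circle_measure) (case_prod f)"
    using assms(2) by (intro P.integrable_const_bound[of _ C]) auto
  show "(\<integral>x. \<integral>y. f x y \<partial>circle_measure \<partial>circle_measure) =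
      (\<integral>y. \<integral>x. f x y \<partial>circle_measure \<partial>circle_measure)"
    using P.Fubini_integral[OF *] by simp
qed

lemma norm_integral_circle_le:
  fixes f :: "real \<Rightarrow> 'a::{banach, second_countable_topology}"
  assumes "\<And>x. norm (f x) \<le> g x" "integrable circle_measure f" "integrable circle_measure g"
  shows "norm (\<integral>x. f x \<partial>circle_measure) \<le> (\<integral>x. g x \<partial>circle_measure)"
  using assms by (intro order_trans[OF integral_norm_bound] integral_mono) auto

section \<open>Mixing\<close>

text \<open>
  A modulus of continuity in mean, which replaces the total variation. Step functions have one,
  it is multiplied by \<open>q\<close> under \<open>x \<mapsto> q x + c\<close>, it is additive under sums and under products of
  functions bounded by \<open>1\<close>, and it only involves integrals.
\<close>

definition L1_lipschitz :: "real \<Rightarrow> (real \<Rightarrow> 'a::{banach, second_countable_topology}) \<Rightarrow> bool" where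
  "L1_lipschitz V f \<longleftrightarrow> (\<forall>h. (\<integral>x. norm (f (x + h) - f x) \<partial>circle_measure) \<le> V * \<bar>h\<bar>)"

text \<open>
  Translating \<open>x\<close> by \<open>y / q\<close> changes \<open>G\<close> by at most \<open>V / q\<close> in mean, but shifts the argument
  of \<open>f\<close> by \<open>y\<close>. Averaging over \<open>y\<close> therefore replaces \<open>f\<close> by its mean, which is \<open>0\<close>. With
  \<open>G\<close> built from slower frequencies, this is the asymptotic independence of \<open>f (q x)\<close> from the past.
\<close>

lemma mixing:
  fixes f G :: "real \<Rightarrow> 'a::{real_normed_field, banach, second_countable_topology}"
  assumes f: "circle_fun f" and f_le: "\<And>x. norm (f x) \<le> C"
    and mean: "(\<integral>x. f x \<partial>circle_measure) = 0"
    and G: "circle_fun G" and V: "L1_lipschitz V G" and q: "q > 0"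
  shows "norm (\<integral>x. G x * f (of_nat q * x + c) \<partial>circle_measure) \<le> C * V / of_nat q"
proof -
  obtain D where D: "\<And>x. norm (G x) \<le> D" by (rule circle_fun_bound[OF G]) blast
  note [measurable] = circle_fun_measurable[OF f] circle_fun_measurable[OF G]
  have C0: "0 \<le> C" using f_le norm_ge_zero by (metis order_trans)
  have D0: "0 \<le> D" using D norm_ge_zero by (metis order_trans)
  have "0 \<le> (\<integral>x. norm (G (x + 1) - G x) \<partial>circle_measure)"
    by (rule Bochner_Integration.integral_nonneg) simp
  also have "\<dots> \<le> V"
    using V[unfolded L1_lipschitz_def, rule_format, of 1] by simp
  finally have V0: "0 \<le> V" .
  let ?Q = "of_nat q :: real"
  let ?F = "\<lambda>x y. f (?Q * x + y + c)"
  let ?I = "\<integral>x. G x * f (?Q * x + c) \<partial>circle_measure"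
  have Q: "?Q > 0" using q by simp
  have Gf: "circle_fun (\<lambda>x. G x * f (?Q * x + c))"
  proof (rule circle_funI[of _ "D * C"])
    show "G (x + 1) * f (?Q * (x + 1) + c) = G x * f (?Q * x + c)" for x
      using circle_fun_add_one[OF G] circle_fun_add_one[OF circle_fun_shift[OF f]] by metis
  qed (auto simp: norm_mult intro!: mult_mono D f_le D0)
  \<comment> \<open>Invariance under \<open>x \<mapsto> x + y / q\<close> makes the integral independent of \<open>y\<close>.\<close>
  have one: "(\<integral>x. G (x + y / ?Q) * ?F x y \<partial>circle_measure) = ?I" for y
    using integral_circle_translate[OF Gf, of "y / ?Q"] Q by (simp add: algebra_simps)
  have bnd: "norm (G u * f v) \<le> D * C" for u v
    by (auto simp: norm_mult intro!: mult_mono D f_le D0)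
  have m1: "(\<lambda>(y, x). G (x + y / ?Q) * ?F x y) \<in> borel_measurable (borel \<Otimes>\<^sub>M borel)"
    by measurable
  have m2: "(\<lambda>(y, x). G x * ?F x y) \<in> borel_measurable (borel \<Otimes>\<^sub>M borel)"
    by measurable
  have ix: "integrable circle_measure (\<lambda>x. G (x + z) * ?F x y)" for y z
    by (rule integrable_circle_bounded[OF _ bnd]) measurable
  have iGh: "integrable circle_measure (\<lambda>x. C * norm (G (x + h) - G x))" for h
  proof (rule integrable_circle_bounded)
    show "norm (C * norm (G (x + h) - G x)) \<le> C * (D + D)" for x
      using C0 norm_triangle_ineq4[of "G (x + h)" "G x"] D[of x] D[of "x + h"]
      by (auto simp: abs_mult intro!: mult_left_mono)
  qed measurable
  have inner: "(\<integral>y. G x * ?F x y \<partial>circle_measure) = 0" for x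
    using integral_circle_translate[OF f, of "?Q * x + c"] mean by (simp add: algebra_simps)
  have zero: "(\<integral>y. \<integral>x. G x * ?F x y \<partial>circle_measure \<partial>circle_measure) = 0"
    unfolding integral_circle_swap(2)[OF m2 bnd] inner by simp
  have close: "norm (?I - (\<integral>x. G x * ?F x y \<partial>circle_measure)) \<le> C * V / ?Q" if "y \<in> {0..<1}" for y
  proof -
    have "?I - (\<integral>x. G x * ?F x y \<partial>circle_measure) =
      (\<integral>x. (G (x + y / ?Q) - G x) * ?F x y \<partial>circle_measure)"
      unfolding one[of y, symmetric] left_diff_distrib
      using ix[of 0 y] ix[of "y / ?Q" y] by simp
    also have "norm \<dots> \<le> (\<integral>x. C * norm (G (x + y / ?Q) - G x) \<partial>circle_measure)"
    proof (rule norm_integral_circle_le)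
      show "integrable circle_measure (\<lambda>x. (G (x + y / ?Q) - G x) * ?F x y)"
        unfolding left_diff_distrib using ix[of 0 y] ix[of "y / ?Q" y] by simp
      show "norm ((G (x + y / ?Q) - G x) * ?F x y) \<le> C * norm (G (x + y / ?Q) - G x)" for x
        by (simp add: norm_mult mult.commute[of C] mult_left_mono f_le)
    qed (rule iGh)
    also have "\<dots> \<le> C * (V * \<bar>y / ?Q\<bar>)"
      using V[unfolded L1_lipschitz_def, rule_format, of "y / ?Q"] C0
      by (subst integral_mult_right_zero) (rule mult_left_mono)
    also have "\<dots> \<le> C * (V * (1 / ?Q))"
      using that C0 V0 Q by (intro mult_left_mono) (auto simp: divide_right_mono)
    finally show ?thesis by simp
  qed
  have iy: "integrable circle_measure (\<lambda>y. \<integral>x. G x * ?F x y \<partial>circle_measure)"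
    using pair_sigma_finite.integrable_fst[OF _ integral_circle_swap(1)[OF m2 bnd]]
    by (simp add: pair_sigma_finite_def circle.sigma_finite_measure_axioms)
  have "?I = (\<integral>y. ?I - (\<integral>x. G x * ?F x y \<partial>circle_measure) \<partial>circle_measure)"
    using zero iy circle.prob_space by simp
  also have "norm \<dots> \<le> (\<integral>y. norm (?I - (\<integral>x. G x * ?F x y \<partial>circle_measure)) \<partial>circle_measure)"
    by (rule integral_norm_bound)
  also have "\<dots> \<le> (\<integral>y. C * V / ?Q \<partial>circle_measure)"
    using close iy by (intro integral_mono) auto
  also have "\<dots> = C * V / ?Q"
    using circle.prob_space by simp
  finally show ?thesis .
qed

text \<open>
  The case \<open>G = 1\<close> of mixing, whose modulus is \<open>0\<close>.
\<close>

lemma integral_circle_dilate: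
  fixes f :: "real \<Rightarrow> 'a::{real_normed_field, banach, second_countable_topology}"
  assumes f: "circle_fun f" and q: "q > 0"
  shows "(\<integral>x. f (of_nat q * x + c) \<partial>circle_measure) = (\<integral>x. f x \<partial>circle_measure)"
proof -
  let ?m = "\<integral>x. f x \<partial>circle_measure"
  obtain C where C: "\<And>x. norm (f x) \<le> C" by (rule circle_fun_bound[OF f]) blast
  note [measurable] = circle_fun_measurable[OF f]
  have "norm (\<integral>x. 1 * (f (of_nat q * x + c) - ?m) \<partial>circle_measure) \<le> (C + norm ?m) * 0 / of_nat q"
  proof (rule mixing[where f = "\<lambda>x. f x - ?m" and G = "\<lambda>_. 1" and V = 0])
    show le: "norm (f x - ?m) \<le> C + norm ?m" for x
      using norm_triangle_ineq4[of "f x" ?m] C[of x] by simp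
    show "circle_fun (\<lambda>x. f x - ?m)"
      by (rule circle_funI[OF _ le]) (auto simp: circle_fun_add_one[OF f])
    show "(\<integral>x. f x - ?m \<partial>circle_measure) = 0"
      using integrable_circle_fun[OF f] circle.prob_space by simp
    show "circle_fun (\<lambda>_. 1 :: 'a)" by (rule circle_funI[of _ 1]) auto
  qed (auto simp: L1_lipschitz_def q)
  then show ?thesis
    using integrable_circle_fun[OF circle_fun_shift[OF f, of q c]] circle.prob_space by simp
qed

lemma integrable_circle_increment:
  fixes f :: "real \<Rightarrow> 'a::{banach, second_countable_topology}"
  assumes f: "circle_fun f"
  shows "integrable circle_measure (\<lambda>x. norm (f (x + h) - f x))"
proof -
  obtain C where C: "\<And>x. norm (f x) \<le> C" by (rule circle_fun_bound[OF f]) blast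
  note [measurable] = circle_fun_measurable[OF f]
  show ?thesis
  proof (rule integrable_circle_bounded)
    show "norm (norm (f (x + h) - f x)) \<le> C + C" for x
      using norm_triangle_ineq4[of "f (x + h)" "f x"] C[of x] C[of "x + h"] by simp
  qed measurable
qed

lemma L1_lipschitz_dilate:
  fixes f :: "real \<Rightarrow> 'a::{banach, second_countable_topology}"
  assumes f: "circle_fun f" and V: "L1_lipschitz V f" and q: "q > 0"
  shows "L1_lipschitz (of_nat q * V) (\<lambda>x. f (of_nat q * x + c))"
  unfolding L1_lipschitz_def
proof
  fix h
  obtain C where C: "\<And>x. norm (f x) \<le> C" by (rule circle_fun_bound[OF f]) blast
  note [measurable] = circle_fun_measurable[OF f]
  let ?k = "\<lambda>x. norm (f (x + of_nat q * h) - f x)"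
  have "circle_fun ?k"
  proof (rule circle_funI[of _ "C + C"])
    show "norm (?k x) \<le> C + C" for x
      using norm_triangle_ineq4[of "f (x + of_nat q * h)" "f x"] C[of x] C[of "x + of_nat q * h"] by simp
    show "?k (x + 1) = ?k x" for x
      using circle_fun_add_one[OF f, of x] circle_fun_add_one[OF f, of "x + of_nat q * h"]
      by (simp add: ac_simps)
  qed measurable
  from integral_circle_dilate[OF this q, of c]
  have "(\<integral>x. norm (f (of_nat q * (x + h) + c) - f (of_nat q * x + c)) \<partial>circle_measure) =
    (\<integral>x. ?k x \<partial>circle_measure)"
    by (simp add: algebra_simps)
  also have "\<dots> \<le> V * \<bar>of_nat q * h\<bar>"
    using V unfolding L1_lipschitz_def by blast
  finally show "(\<integral>x. norm (f (of_nat q * (x + h) + c) - f (of_nat q * x + c)) \<partial>circle_measure)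
      \<le> of_nat q * V * \<bar>h\<bar>"
    by (simp add: abs_mult mult_ac)
qed

lemma L1_lipschitz_add:
  assumes f: "circle_fun f" "L1_lipschitz V f" and g: "circle_fun g" "L1_lipschitz W g"
  shows "L1_lipschitz (V + W) (\<lambda>x. f x + g x)"
  unfolding L1_lipschitz_def
proof
  fix h
  let ?f = "\<lambda>x. norm (f (x + h) - f x)" and ?g = "\<lambda>x. norm (g (x + h) - g x)"
  note [simp] = integrable_circle_increment[OF f(1)] integrable_circle_increment[OF g(1)]
  have "(\<integral>x. norm (f (x + h) + g (x + h) - (f x + g x)) \<partial>circle_measure)
      \<le> (\<integral>x. ?f x + ?g x \<partial>circle_measure)"
    by (rule integral_mono')
       (use norm_triangle_ineq[of "f (_ + h) - f _" "g (_ + h) - g _"] in \<open>auto simp: algebra_simps\<close>)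
  also have "\<dots> \<le> V * \<bar>h\<bar> + W * \<bar>h\<bar>"
    using f(2) g(2) unfolding L1_lipschitz_def by (simp add: add_mono)
  finally show "(\<integral>x. norm (f (x + h) + g (x + h) - (f x + g x)) \<partial>circle_measure)
      \<le> (V + W) * \<bar>h\<bar>"
    by (simp add: algebra_simps)
qed

lemma L1_lipschitz_mult:
  fixes f g :: "real \<Rightarrow> 'a::{real_normed_field, banach, second_countable_topology}"
  assumes f: "circle_fun f" "L1_lipschitz V f" "\<And>x. norm (f x) \<le> 1"
    and g: "circle_fun g" "L1_lipschitz W g" "\<And>x. norm (g x) \<le> 1"
  shows "L1_lipschitz (V + W) (\<lambda>x. f x * g x)"
  unfolding L1_lipschitz_def
proof
  fix h
  let ?f = "\<lambda>x. norm (f (x + h) - f x)" and ?g = "\<lambda>x. norm (g (x + h) - g x)"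
  note [simp] = integrable_circle_increment[OF f(1)] integrable_circle_increment[OF g(1)]
  have "norm (f (x + h) * g (x + h) - f x * g x) \<le> ?f x + ?g x" for x
  proof -
    have "f (x + h) * g (x + h) - f x * g x =
        (f (x + h) - f x) * g (x + h) + f x * (g (x + h) - g x)"
      by (simp add: algebra_simps)
    also have "norm \<dots> \<le> ?f x * norm (g (x + h)) + norm (f x) * ?g x"
      using norm_triangle_ineq by (simp flip: norm_mult)
    also have "\<dots> \<le> ?f x * 1 + 1 * ?g x"
      by (intro add_mono mult_mono f(3) g(3)) auto
    finally show ?thesis by simp
  qed
  then have "(\<integral>x. norm (f (x + h) * g (x + h) - f x * g x) \<partial>circle_measure)
      \<le> (\<integral>x. ?f x + ?g x \<partial>circle_measure)"
    by (intro integral_mono') auto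
  also have "\<dots> \<le> V * \<bar>h\<bar> + W * \<bar>h\<bar>"
    using f(2) g(2) unfolding L1_lipschitz_def by (simp add: add_mono)
  finally show "(\<integral>x. norm (f (x + h) * g (x + h) - f x * g x) \<partial>circle_measure)
      \<le> (V + W) * \<bar>h\<bar>"
    by (simp add: algebra_simps)
qed

lemma L1_lipschitz_const: "L1_lipschitz 0 (\<lambda>_. c)"
  unfolding L1_lipschitz_def by simp

lemma L1_lipschitz_compose:
  assumes f: "circle_fun f" "L1_lipschitz V f"
    and F: "\<And>x y. norm (F (f x) - F (f y)) \<le> K * norm (f x - f y)" and K: "0 \<le> K"
  shows "L1_lipschitz (K * V) (\<lambda>x. F (f x))"
  unfolding L1_lipschitz_def
proof
  fix h
  note [simp] = integrable_circle_increment[OF f(1)]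
  have "(\<integral>x. norm (F (f (x + h)) - F (f x)) \<partial>circle_measure)
      \<le> (\<integral>x. K * norm (f (x + h) - f x) \<partial>circle_measure)"
    using K by (intro integral_mono' F) auto
  also have "\<dots> \<le> K * (V * \<bar>h\<bar>)"
    using f(2) K unfolding L1_lipschitz_def by (simp add: mult_left_mono)
  finally show "(\<integral>x. norm (F (f (x + h)) - F (f x)) \<partial>circle_measure) \<le> K * V * \<bar>h\<bar>"
    by (simp add: mult_ac)
qed

section \<open>The centred indicator\<close>

lemma circle_fun_frac: "circle_fun frac"
proof (rule circle_funI[of _ 1])
  show "norm (frac x) \<le> 1" for x :: real using frac_lt_1[of x] by simp
  show "frac (x + 1) = frac x" for x :: real by (simp add: frac_def)
qed measurable

text \<open>
  On the circle \<open>\<lfloor>x + z\<rfloor> = frac x + z - frac (x + z)\<close>, and the two fractional parts have the same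
  integral by translation invariance.
\<close>

lemma integrable_floor: "integrable circle_measure (\<lambda>x. real_of_int \<lfloor>x + z\<rfloor>)"
  and integral_floor: "(\<integral>x. real_of_int \<lfloor>x + z\<rfloor> \<partial>circle_measure) = z"
proof -
  have eq: "real_of_int \<lfloor>x + z\<rfloor> = frac x + z - frac (x + z)" if "x \<in> space circle_measure" for x
  proof -
    have "frac x = x" using that by (simp add: frac_eq)
    then show ?thesis by (simp add: frac_def)
  qed
  have int: "integrable circle_measure frac" "integrable circle_measure (\<lambda>x. frac (x + z))"
    using integrable_circle_fun[OF circle_fun_frac]
      integrable_circle_fun[OF circle_fun_shift[OF circle_fun_frac, of 1 z]] by auto
  show "integrable circle_measure (\<lambda>x. real_of_int \<lfloor>x + z\<rfloor>)"
    using int by (subst Bochner_Integration.integrable_cong[OF refl eq]) auto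
  show "(\<integral>x. real_of_int \<lfloor>x + z\<rfloor> \<partial>circle_measure) = z"
    using int circle.prob_space integral_circle_translate[OF circle_fun_frac, of z]
    by (subst Bochner_Integration.integral_cong[OF refl eq]) auto
qed

lemma L1_floor_translate:
  "(\<integral>x. \<bar>real_of_int \<lfloor>x + y\<rfloor> - real_of_int \<lfloor>x + z\<rfloor>\<bar> \<partial>circle_measure) = \<bar>y - z\<bar>"
proof (induction y z rule: linorder_wlog)
  case (le y z)
  then have "\<bar>real_of_int \<lfloor>x + y\<rfloor> - real_of_int \<lfloor>x + z\<rfloor>\<bar> = real_of_int \<lfloor>x + z\<rfloor> - real_of_int \<lfloor>x + y\<rfloor>" for x
    using floor_mono[of "x + y" "x + z"] by simp
  then show ?case
    using le integrable_floor[of y] integrable_floor[of z] by (simp add: integral_floor)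
next
  case (sym y z)
  then show ?case by (simp add: abs_minus_commute)
qed

text \<open>
  Written with floors, the indicator is a difference of two monotone functions. This gives
  its modulus of continuity and allows Hermite's identity to be used for its sums.
\<close>

lemma centred_indicator_floor:
  assumes "0 \<le> \<beta>" "\<beta> < 1"
  shows "centred_indicator \<beta> u = real_of_int \<lfloor>u\<rfloor> - real_of_int \<lfloor>u - \<beta>\<rfloor> - \<beta>"
proof -
  have u: "u = of_int \<lfloor>u\<rfloor> + frac u" by (simp add: frac_def)
  show ?thesis
  proof (cases "frac u < \<beta>")
    case True
    then have "\<lfloor>u - \<beta>\<rfloor> = \<lfloor>u\<rfloor> - 1"
      using assms u frac_ge_0[of u] by linarith
    then show ?thesis using True frac_ge_0[of u] by (simp add: centred_indicator_def)
  next
    case False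
    then have "\<lfloor>u - \<beta>\<rfloor> = \<lfloor>u\<rfloor>"
      using assms u frac_lt_1[of u] by linarith
    then show ?thesis using False by (simp add: centred_indicator_def)
  qed
qed

lemma abs_centred_indicator_le:
  assumes "0 \<le> \<beta>" "\<beta> < 1"
  shows "\<bar>centred_indicator \<beta> u\<bar> \<le> 1"
  using assms by (auto simp: centred_indicator_def indicator_def)

lemma circle_fun_centred_indicator:
  assumes "0 \<le> \<beta>" "\<beta> < 1"
  shows "circle_fun (centred_indicator \<beta>)"
proof (rule circle_funI[of _ 1])
  show "centred_indicator \<beta> (x + 1) = centred_indicator \<beta> x" for x
    using circle_fun_add_one[OF circle_fun_frac, of x] by (simp add: centred_indicator_def)
qed (use assms in \<open>auto simp: abs_centred_indicator_le\<close>)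

lemma L1_centred_indicator_translate:
  assumes \<beta>: "0 \<le> \<beta>" "\<beta> < 1"
  shows "(\<integral>x. \<bar>centred_indicator \<beta> (x + y) - centred_indicator \<beta> (x + z)\<bar> \<partial>circle_measure)
    \<le> 2 * \<bar>y - z\<bar>"
proof -
  let ?d = "\<lambda>y z x. \<bar>real_of_int \<lfloor>x + y\<rfloor> - real_of_int \<lfloor>x + z\<rfloor>\<bar>"
  have int [simp]: "integrable circle_measure (?d y z)" for y z
    using integrable_floor by auto
  have "(\<integral>x. \<bar>centred_indicator \<beta> (x + y) - centred_indicator \<beta> (x + z)\<bar> \<partial>circle_measure)
      \<le> (\<integral>x. ?d y z x + ?d (y - \<beta>) (z - \<beta>) x \<partial>circle_measure)"
  proof (rule integral_mono')
    show "\<bar>centred_indicator \<beta> (x + y) - centred_indicator \<beta> (x + z)\<bar> \<le>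
        ?d y z x + ?d (y - \<beta>) (z - \<beta>) x" for x
      unfolding centred_indicator_floor[OF \<beta>] add_diff_eq by linarith
  qed auto
  also have "\<dots> = 2 * \<bar>y - z\<bar>"
    by (simp add: L1_floor_translate)
  finally show ?thesis .
qed

lemma L1_lipschitz_centred_indicator:
  assumes "0 \<le> \<beta>" "\<beta> < 1"
  shows "L1_lipschitz 2 (centred_indicator \<beta>)"
  using L1_centred_indicator_translate[OF assms, of _ 0] unfolding L1_lipschitz_def by simp

lemma integral_centred_indicator:
  assumes "0 \<le> \<beta>" "\<beta> < 1"
  shows "(\<integral>x. centred_indicator \<beta> x \<partial>circle_measure) = 0"
  using integrable_floor[of 0] integrable_floor[of "-\<beta>"] integral_floor[of 0] integral_floor[of "-\<beta>"]
    circle.prob_space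
  by (simp add: centred_indicator_floor[OF assms])

lemma integral_centred_indicator_square:
  assumes "0 \<le> \<beta>" "\<beta> < 1"
  shows "(\<integral>x. (centred_indicator \<beta> x)\<^sup>2 \<partial>circle_measure) = \<beta> * (1 - \<beta>)"
proof -
  have "(centred_indicator \<beta> x)\<^sup>2 = (1 - 2 * \<beta>) * centred_indicator \<beta> x + \<beta> * (1 - \<beta>)" for x
    by (auto simp: centred_indicator_def indicator_def power2_eq_square algebra_simps)
  then show ?thesis
    using integrable_circle_fun[OF circle_fun_centred_indicator[OF assms]]
      integral_centred_indicator[OF assms] circle.prob_space
    by simp
qed

section \<open>Sums over rational rotations\<close>

lemma sum_div_shift:
  fixes m :: int
  assumes q: "q > (0::nat)"
  shows "(\<Sum>i<q. (m + int i) div int q) = m"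
proof -
  define d e where "d = m div int q" and "e = nat (m mod int q)"
  have e: "int e = m mod int q" "e < q"
    using q pos_mod_bound[of "int q" m] unfolding e_def by (auto simp: nat_less_iff)
  have m: "m = int q * d + int e" unfolding d_def e by simp
  have "(m + int i) div int q = d + (if q - e \<le> i then 1 else 0)" if i: "i < q" for i
  proof -
    have "(m + int i) div int q = (int (e + i) + int q * d) div int q"
      by (subst m) (simp add: add_ac)
    also have "\<dots> = d + int ((e + i) div q)"
      using q by (simp add: zdiv_int)
    also have "(e + i) div q = (if q - e \<le> i then 1 else 0)"
      using e(2) i by (auto simp: div_eq_0_iff div_nat_eqI)
    finally show ?thesis by simp
  qed
  then have "(\<Sum>i<q. (m + int i) div int q) = (\<Sum>i<q. d + (if q - e \<le> i then 1 else 0))"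
    by simp
  also have "\<dots> = int q * d + int (card {i \<in> {..<q}. q - e \<le> i})"
    by (simp add: sum.distrib sum.If_cases Int_def)
  also have "{i \<in> {..<q}. q - e \<le> i} = {q - e..<q}" by auto
  also have "int q * d + int (card {q - e..<q}) = m"
    by (subst m) (use e(2) in simp)
  finally show ?thesis .
qed

lemma Hermite_identity:
  fixes u :: real and q :: nat
  assumes q: "q > 0"
  shows "(\<Sum>i<q. \<lfloor>u + i / q\<rfloor>) = \<lfloor>q * u\<rfloor>"
proof -
  have "\<lfloor>u + i / q\<rfloor> = (\<lfloor>q * u\<rfloor> + int i) div int q" for i :: nat
  proof -
    have "\<lfloor>(q * u + i) / q\<rfloor> = \<lfloor>q * u + i\<rfloor> div int q"
      using floor_divide_real_eq_div[of "int q" "q * u + i"] q by simp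
    also have "(q * u + i) / q = u + i / q" using q by (simp add: field_simps)
    finally show ?thesis by simp
  qed
  then show ?thesis using sum_div_shift[OF q, of "\<lfloor>q * u\<rfloor>"] by simp
qed

text \<open>
  Over a coset of the subgroup of order \<open>q\<close>, the function reproduces itself: the sum has the
  same form, with the endpoint \<open>\<beta>\<close> replaced by the fractional part of \<open>q \<beta>\<close>.
\<close>

lemma sum_centred_indicator_cosets:
  fixes q :: nat and u \<beta> :: real
  assumes q: "q > 0" and \<beta>: "0 \<le> \<beta>" "\<beta> < 1"
  shows "(\<Sum>i<q. centred_indicator \<beta> (u + i / q)) = centred_indicator (frac (q * \<beta>)) (q * u)"
proof -
  have fl: "\<lfloor>q * u - q * \<beta>\<rfloor> = \<lfloor>q * u - frac (q * \<beta>)\<rfloor> - \<lfloor>q * \<beta>\<rfloor>"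
    unfolding frac_def by (simp add: algebra_simps flip: floor_diff_of_int)
  have "(\<Sum>i<q. centred_indicator \<beta> (u + i / q)) =
      of_int (\<Sum>i<q. \<lfloor>u + i / q\<rfloor>) - of_int (\<Sum>i<q. \<lfloor>(u - \<beta>) + i / q\<rfloor>) - q * \<beta>"
    by (simp add: centred_indicator_floor[OF \<beta>] sum_subtractf diff_add_eq)
  also have "\<dots> = of_int \<lfloor>q * u\<rfloor> - of_int \<lfloor>q * u - q * \<beta>\<rfloor> - q * \<beta>"
    unfolding Hermite_identity[OF q] by (simp add: right_diff_distrib)
  also have "\<dots> = centred_indicator (frac (q * \<beta>)) (q * u)"
    unfolding fl centred_indicator_floor[OF frac_ge_0 frac_lt_1] by (simp add: frac_def)
  finally show ?thesis .
qed

text \<open>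
  Multiplication by \<open>p\<close> permutes the residues modulo \<open>q\<close>.
\<close>

lemma sum_circle_fun_rational:
  fixes f :: "real \<Rightarrow> 'a::real_normed_vector" and q :: nat
  assumes f: "circle_fun f" and q: "q > 0" and p: "coprime p (int q)"
  shows "(\<Sum>i=1..q. f (u + i * (p / q))) = (\<Sum>i<q. f (u + i / q))"
proof -
  let ?r = "\<lambda>i. nat (int i * p mod int q)"
  have r: "?r i < q" for i using q by (simp add: nat_less_iff)
  have inj: "inj_on ?r {1..q}"
  proof (rule inj_onI)
    fix i j assume ij: "i \<in> {1..q}" "j \<in> {1..q}" "?r i = ?r j"
    then have "int i * p mod int q = int j * p mod int q"
      using q by (simp add: nat_eq_iff)
    then have "int q dvd (int i - int j) * p"
      by (simp add: mod_eq_dvd_iff left_diff_distrib)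
    then have "int q dvd int i - int j"
      using p coprime_dvd_mult_left_iff[of "int q" p] by (simp add: coprime_commute)
    moreover have "\<bar>int i - int j\<bar> < int q" using ij by auto
    ultimately show "i = j" using zdvd_not_zless[of "\<bar>int i - int j\<bar>" "int q"] by fastforce
  qed
  have "card (?r ` {1..q}) = q"
    using card_image[OF inj] by simp
  then have "?r ` {1..q} = {..<q}"
    by (intro card_subset_eq) (use r in auto)
  then have bij: "bij_betw ?r {1..q} {..<q}" using inj by (simp add: bij_betw_def)
  have "f (u + i * (p / q)) = f (u + ?r i / q)" for i
  proof -
    define d e where "d = int i * p div int q" and "e = int i * p mod int q"
    have "real_of_int (int i * p) = of_int (int q * d + e)"
      unfolding d_def e_def mult_div_mod_eq ..
    then have *: "real i * p = q * d + e" by simp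
    have e: "real (?r i) = e" using q unfolding e_def by simp
    have "i * (p / q) = d + ?r i / q"
      unfolding e using q * by (simp add: field_simps)
    then show ?thesis
      using circle_fun_add_int[OF f, of "u + ?r i / q" d]
      by (simp add: ac_simps)
  qed
  then show ?thesis
    using sum.reindex_bij_betw[OF bij, of "\<lambda>i. f (u + i / q)"] by simp
qed

text \<open>
  Over \<open>q\<close> steps the orbit under \<open>\<alpha>\<close> stays within \<open>\<bar>q \<alpha> - p\<bar>\<close> of the orbit under \<open>p / q\<close>, and each
  of the \<open>q\<close> terms changes in mean by at most twice this distance.
\<close>

lemma L1_block_approximation:
  fixes \<alpha> \<beta> c :: real and p :: int and q :: nat
  assumes q: "q > 0" and p: "coprime p (int q)" and \<beta>: "0 \<le> \<beta>" "\<beta> < 1"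
  shows "(\<integral>x. \<bar>(\<Sum>i=1..q. centred_indicator \<beta> (x + c + i * \<alpha>)) -
      centred_indicator (frac (q * \<beta>)) (q * x + q * c)\<bar> \<partial>circle_measure) \<le>
    2 * (q * \<bar>q * \<alpha> - p\<bar>)"
proof -
  let ?d = "\<lambda>i x. \<bar>centred_indicator \<beta> (x + (c + i * \<alpha>)) - centred_indicator \<beta> (x + (c + i * (p / q)))\<bar>"
  have int [simp]: "integrable circle_measure (\<lambda>x. centred_indicator \<beta> (x + y))" for y
    using integrable_circle_fun[OF circle_fun_shift[OF circle_fun_centred_indicator[OF \<beta>], of 1 y]]
    by simp
  have "\<bar>(\<Sum>i=1..q. centred_indicator \<beta> (x + c + i * \<alpha>)) -
      centred_indicator (frac (q * \<beta>)) (q * x + q * c)\<bar> \<le> (\<Sum>i=1..q. ?d i x)" for x :: real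
  proof -
    have "centred_indicator (frac (q * \<beta>)) (q * x + q * c) =
        (\<Sum>i=1..q. centred_indicator \<beta> ((x + c) + i * (p / q)))"
      unfolding sum_circle_fun_rational[OF circle_fun_centred_indicator[OF \<beta>] q p]
        sum_centred_indicator_cosets[OF q \<beta>]
      by (simp add: distrib_left)
    then show ?thesis
      by (simp add: add.assoc flip: sum_subtractf)
  qed
  then have "(\<integral>x. \<bar>(\<Sum>i=1..q. centred_indicator \<beta> (x + c + i * \<alpha>)) -
      centred_indicator (frac (q * \<beta>)) (q * x + q * c)\<bar> \<partial>circle_measure) \<le>
    (\<integral>x. (\<Sum>i=1..q. ?d i x) \<partial>circle_measure)"
    by (intro integral_mono') auto
  also have "\<dots> = (\<Sum>i=1..q. \<integral>x. ?d i x \<partial>circle_measure)"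
    by (intro Bochner_Integration.integral_sum) auto
  also have "\<dots> \<le> (\<Sum>i=1..q. 2 * \<bar>q * \<alpha> - p\<bar>)"
  proof (rule sum_mono)
    fix i assume i: "i \<in> {1..q}"
    have "(\<integral>x. ?d i x \<partial>circle_measure) \<le> 2 * \<bar>(c + i * \<alpha>) - (c + i * (p / q))\<bar>"
      by (rule L1_centred_indicator_translate[OF \<beta>])
    also have "\<dots> = 2 * (i / q * \<bar>q * \<alpha> - p\<bar>)"
    proof -
      have "(c + i * \<alpha>) - (c + i * (p / q)) = i / q * (q * \<alpha> - p)"
        using q by (simp add: field_simps)
      then show ?thesis by (simp add: abs_mult)
    qed
    also have "\<dots> \<le> 2 * (1 * \<bar>q * \<alpha> - p\<bar>)"
      using i q by (intro mult_left_mono mult_right_mono) auto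
    finally show "(\<integral>x. ?d i x \<partial>circle_measure) \<le> 2 * \<bar>q * \<alpha> - p\<bar>" by simp
  qed
  also have "\<dots> = 2 * (q * \<bar>q * \<alpha> - p\<bar>)"
    by simp
  finally show ?thesis .
qed

section \<open>A law of large numbers\<close>

text \<open>
  Along the squares the second moments of the averages are summable, so the averages tend to
  \<open>0\<close> almost surely; between \<open>m\<^sup>2\<close> and \<open>(m + 1)\<^sup>2\<close> a sum of terms
  bounded by \<open>1\<close> moves by at most \<open>2 m\<close>, which is negligible against \<open>m\<^sup>2\<close>.
\<close>

lemma (in prob_space) averages_tend_to_0:
  fixes g :: "nat \<Rightarrow> 'a \<Rightarrow> real" and K :: real
  assumes meas [measurable]: "\<And>k. g k \<in> borel_measurable M"
    and bound: "\<And>k x. \<bar>g k x\<bar> \<le> 1"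
    and second_moment: "\<And>n. expectation (\<lambda>x. (\<Sum>k<n. g k x)\<^sup>2) \<le> K * n"
  shows "AE x in M. (\<lambda>n. (\<Sum>k<n. g k x) / real n) \<longlonglongrightarrow> 0"
proof -
  define S where "S n x = (\<Sum>k<n. g k x)" for n x
  define h where "h n x = (S ((Suc n)\<^sup>2) x / (Suc n)\<^sup>2)\<^sup>2" for n x
  have S_meas [measurable]: "S n \<in> borel_measurable M" for n
    unfolding S_def by measurable
  have h_meas [measurable]: "h n \<in> borel_measurable M" for n
    unfolding h_def by measurable
  have S_diff: "\<bar>S n x - S m x\<bar> \<le> real (n - m)" if "m \<le> n" for m n x
  proof -
    have "S n x - S m x = (\<Sum>k=m..<n. g k x)"
      unfolding S_def lessThan_atLeast0 using sum.atLeastLessThan_concat[of 0 m n "\<lambda>k. g k x"] that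
      by simp
    also have "\<bar>\<dots>\<bar> \<le> (\<Sum>k=m..<n. \<bar>g k x\<bar>)" by (rule sum_abs)
    also have "\<dots> \<le> real (card {m..<n}) * 1" by (rule sum_bounded_above) (rule bound)
    finally show ?thesis by simp
  qed
  have S_le: "\<bar>S n x\<bar> \<le> real n" for n x
    using S_diff[of 0 n x] by (simp add: S_def)
  have h_le: "h n x \<le> 1" for n x
    using S_le[of "(Suc n)\<^sup>2" x] unfolding h_def
    by (simp add: abs_square_le_1 del: of_nat_Suc of_nat_power)
  have h_nonneg: "0 \<le> h n x" for n x unfolding h_def by simp
  have h_int: "integrable M (h n)" for n
    using h_le h_nonneg by (intro integrable_const_bound[of _ 1]) auto
  have "0 \<le> expectation (\<lambda>x. (\<Sum>k<1. g k x)\<^sup>2)"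
    by (rule Bochner_Integration.integral_nonneg) simp
  also have "\<dots> \<le> K" using second_moment[of 1] by simp
  finally have K: "0 \<le> K" .
  have h_exp: "expectation (h n) \<le> K / (Suc n)\<^sup>2" for n
  proof -
    have "expectation (h n) = expectation (\<lambda>x. (S ((Suc n)\<^sup>2) x)\<^sup>2) / (real ((Suc n)\<^sup>2))\<^sup>2"
      unfolding h_def power_divide by simp
    also have "\<dots> \<le> K * real ((Suc n)\<^sup>2) / (real ((Suc n)\<^sup>2))\<^sup>2"
      using second_moment[of "(Suc n)\<^sup>2"] unfolding S_def by (intro divide_right_mono) auto
    also have "\<dots> = K / (Suc n)\<^sup>2" by (simp add: power2_eq_square del: of_nat_Suc)
    finally show ?thesis .
  qed
  have summ: "summable (\<lambda>n. K / (Suc n)\<^sup>2)"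
    using summable_mult[OF iffD2[OF summable_Suc_iff inverse_power_summable[of 2, where 'a = real]], of K]
    by (simp add: field_simps)
  have "(\<integral>\<^sup>+x. (\<Sum>n. ennreal (h n x)) \<partial>M) = (\<Sum>n. \<integral>\<^sup>+x. ennreal (h n x) \<partial>M)"
    by (rule nn_integral_suminf) measurable
  also have "\<dots> = (\<Sum>n. ennreal (expectation (h n)))"
    by (simp add: nn_integral_eq_integral[OF h_int] h_nonneg)
  also have "\<dots> \<le> (\<Sum>n. ennreal (K / (Suc n)\<^sup>2))"
    by (intro suminf_le ennreal_leI h_exp) auto
  also have "\<dots> = ennreal (\<Sum>n. K / (Suc n)\<^sup>2)"
    by (rule suminf_ennreal2) (use K summ in auto)
  finally have "(\<integral>\<^sup>+x. (\<Sum>n. ennreal (h n x)) \<partial>M) \<noteq> \<infinity>"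
    by (auto simp: top_unique)
  then have "AE x in M. (\<Sum>n. ennreal (h n x)) \<noteq> \<infinity>"
    by (intro nn_integral_PInf_AE) auto
  then show ?thesis
  proof (rule AE_mp, intro AE_I2 impI)
    fix x assume "(\<Sum>n. ennreal (h n x)) \<noteq> \<infinity>"
    then have "summable (\<lambda>n. h n x)"
      using h_nonneg by (intro summable_suminf_not_top) auto
    then have "(\<lambda>n. sqrt (h n x)) \<longlonglongrightarrow> sqrt 0"
      by (intro tendsto_real_sqrt summable_LIMSEQ_zero)
    then have "(\<lambda>n. \<bar>S ((Suc n)\<^sup>2) x / (Suc n)\<^sup>2\<bar>) \<longlonglongrightarrow> 0"
      unfolding h_def real_sqrt_abs by simp
    then have sq: "(\<lambda>n. \<bar>S (n\<^sup>2) x / n\<^sup>2\<bar>) \<longlonglongrightarrow> 0"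
      by (subst (asm) filterlim_sequentially_Suc)
    have root: "filterlim floor_sqrt sequentially sequentially"
      unfolding filterlim_at_top
    proof
      fix Z show "\<forall>\<^sub>F n in sequentially. Z \<le> floor_sqrt n"
        using eventually_ge_at_top[of "Z\<^sup>2"] by eventually_elim (simp add: le_floor_sqrt_iff)
    qed
    let ?u = "\<lambda>m. \<bar>S (m\<^sup>2) x / m\<^sup>2\<bar> + 2 / real m"
    have "?u \<longlonglongrightarrow> 0 + 0"
      by (intro tendsto_add sq lim_const_over_n)
    then have "(\<lambda>n. ?u (floor_sqrt n)) \<longlonglongrightarrow> 0"
      using filterlim_compose[OF _ root, of ?u "nhds 0"] by simp
    moreover have "\<forall>\<^sub>F n in sequentially. norm (S n x / n) \<le> ?u (floor_sqrt n)"
      using eventually_gt_at_top[of 0]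
    proof eventually_elim
      case (elim n)
      define m where "m = floor_sqrt n"
      have m: "0 < m" "m\<^sup>2 \<le> n" "n \<le> m\<^sup>2 + 2 * m"
        using elim Suc_floor_sqrt_power2_gt[of n] floor_sqrt_power2_le[of n]
        unfolding m_def by (auto simp: power2_eq_square)
      have "real (n - m\<^sup>2) \<le> real (2 * m)"
        using m by (intro of_nat_mono) simp
      then have "\<bar>S n x\<bar> \<le> \<bar>S (m\<^sup>2) x\<bar> + 2 * m"
        using S_diff[OF m(2), of x] by simp
      then have "\<bar>S n x\<bar> / n \<le> (\<bar>S (m\<^sup>2) x\<bar> + 2 * m) / m\<^sup>2"
        using m elim by (intro frac_le) (auto simp flip: of_nat_power)
      also have "\<dots> = ?u m"
        using m by (simp add: add_divide_distrib power2_eq_square abs_mult)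
      finally show ?case unfolding m_def by simp
    qed
    ultimately have "(\<lambda>n. S n x / n) \<longlonglongrightarrow> 0"
      by (rule Lim_null_comparison[rotated])
    then show "(\<lambda>n. (\<Sum>k<n. g k x) / n) \<longlonglongrightarrow> 0" unfolding S_def .
  qed
qed

section \<open>Equidistribution of variances\<close>

text \<open>
  Translation by \<open>h\<close> changes \<open>frac\<close> by \<open>h\<close> minus an increment of the floor function, and the
  latter has mean absolute value \<open>\<bar>h\<bar>\<close>.
\<close>

lemma L1_lipschitz_frac: "L1_lipschitz 2 (frac :: real \<Rightarrow> real)"
  unfolding L1_lipschitz_def
proof
  fix h :: real
  let ?d = "\<lambda>x. \<bar>real_of_int \<lfloor>x + h\<rfloor> - real_of_int \<lfloor>x\<rfloor>\<bar>"
  have [simp]: "integrable circle_measure ?d"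
    using integrable_floor[of h] integrable_floor[of 0, simplified] by (intro integrable_abs Bochner_Integration.integrable_diff)
  have "(\<integral>x. norm (frac (x + h) - frac x) \<partial>circle_measure) \<le> (\<integral>x. \<bar>h\<bar> + ?d x \<partial>circle_measure)"
  proof (rule integral_mono')
    show "norm (frac (x + h) - frac x) \<le> \<bar>h\<bar> + ?d x" for x
      unfolding frac_def real_norm_def by simp
  qed auto
  also have "\<dots> = 2 * \<bar>h\<bar>"
    using circle.prob_space L1_floor_translate[of h 0]
    by (subst Bochner_Integration.integral_add) simp_all
  finally show "(\<integral>x. norm (frac (x + h) - frac x) \<partial>circle_measure) \<le> 2 * \<bar>h\<bar>" .
qed

text \<open>
  The variance of \<open>centred_indicator (frac y)\<close> is \<open>frac y * (1 - frac y)\<close>; its mean over the circle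
  is \<open>1 / 6\<close>, the source of the factor \<open>sqrt 6\<close> in the normalisation.
\<close>

definition centred_variance :: "real \<Rightarrow> real" where
  "centred_variance y = frac y * (1 - frac y) - 1 / 6"

lemma abs_centred_variance_le: "\<bar>centred_variance y\<bar> \<le> 1"
proof -
  have "0 \<le> frac y * (1 - frac y)" "frac y * (1 - frac y) \<le> 1 * 1"
    using frac_ge_0[of y] frac_lt_1[of y] by (intro mult_nonneg_nonneg mult_mono; simp)+
  then show ?thesis unfolding centred_variance_def by auto
qed

lemma circle_fun_centred_variance: "circle_fun centred_variance"
proof (rule circle_funI[of _ 1])
  show "centred_variance \<in> borel_measurable borel"
    unfolding centred_variance_def by (intro borel_measurable_diff borel_measurable_times) measurable
  show "centred_variance (x + 1) = centred_variance x" for x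
    unfolding centred_variance_def circle_fun_add_one[OF circle_fun_frac] ..
qed (simp add: abs_centred_variance_le)

lemma L1_lipschitz_centred_variance: "L1_lipschitz 2 centred_variance"
proof -
  have "L1_lipschitz (1 * 2) (\<lambda>x. (\<lambda>u. u * (1 - u) - 1 / 6) (frac x))"
  proof (rule L1_lipschitz_compose[OF circle_fun_frac L1_lipschitz_frac])
    fix x y :: real
    have "frac x * (1 - frac x) - 1 / 6 - (frac y * (1 - frac y) - 1 / 6) =
        (1 - frac x - frac y) * (frac x - frac y)"
      by (simp add: algebra_simps)
    moreover have "\<bar>1 - frac x - frac y\<bar> \<le> 1"
      using frac_ge_0[of x] frac_lt_1[of x] frac_ge_0[of y] frac_lt_1[of y] by linarith
    ultimately show "norm (frac x * (1 - frac x) - 1 / 6 - (frac y * (1 - frac y) - 1 / 6))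
        \<le> 1 * norm (frac x - frac y)"
      unfolding real_norm_def by (metis abs_ge_zero abs_mult mult_right_mono)
  qed simp
  then show ?thesis unfolding centred_variance_def by simp
qed

lemma integral_centred_variance: "(\<integral>x. centred_variance x \<partial>circle_measure) = 0"
proof -
  have pow: "(\<integral>x. indicator {0..<1::real} x *\<^sub>R x ^ k \<partial>lborel) = 1 / Suc k" for k
  proof -
    have "(\<integral>x. indicator {0..<1::real} x *\<^sub>R x ^ k \<partial>lborel) = (\<integral>x. x ^ k * indicator {0..1} x \<partial>lborel)"
    proof (rule integral_cong_AE)
      show "AE x in lborel. indicator {0..<1::real} x *\<^sub>R x ^ k = x ^ k * indicator {0..1} x"
        using AE_lborel_singleton[of "1::real"] by eventually_elim (auto simp: indicator_def)
    qed auto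
    then show ?thesis using integral_power[of 0 1 k] by simp
  qed
  have pow': "(\<integral>x. x ^ k \<partial>circle_measure) = 1 / Suc k" for k
    unfolding integral_circle using pow by simp
  have int: "integrable circle_measure (\<lambda>x. x ^ k)" for k
    by (rule circle.integrable_const_bound[of _ 1]) (auto intro: measurable_circle simp: power_le_one)
  have "(\<integral>x. centred_variance x \<partial>circle_measure) = (\<integral>x. x ^ 1 - x ^ 2 - 1 / 6 \<partial>circle_measure)"
    by (rule Bochner_Integration.integral_cong)
       (auto simp: centred_variance_def frac_eq power2_eq_square algebra_simps)
  also have "\<dots> = 0"
    using int[of 1] int[of 2] pow'[of 1] pow'[of 2] circle.prob_space by simp
  finally show ?thesis .
qed

text \<open>
  The factor \<open>2 ^ k\<close> makes the ratios of the earlier frequencies to the present one summable,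
  so that the mixing errors have a bounded sum.
\<close>

locale lacunary =
  fixes Q :: "nat \<Rightarrow> nat"
  assumes Q_pos: "\<And>k. 0 < Q k"
    and gap: "\<And>k. (\<Sum>i<k. Q i) * 2 ^ k \<le> Q k"
begin

lemma gap_ratio: "real (\<Sum>i<k. Q i) / Q k \<le> (1 / 2) ^ k"
proof -
  have "real (\<Sum>i<k. Q i) * 2 ^ k \<le> Q k"
    using gap[of k] by (metis of_nat_le_iff of_nat_mult of_nat_numeral of_nat_power)
  then show ?thesis
    using Q_pos[of k] by (simp add: divide_simps mult.commute)
qed

lemma L1_lipschitz_sum_dilates:
  assumes f: "circle_fun f" "L1_lipschitz V f"
  shows "circle_fun (\<lambda>x. \<Sum>k<n. f (Q k * x))"
    and "L1_lipschitz (V * real (\<Sum>k<n. Q k)) (\<lambda>x. \<Sum>k<n. f (Q k * x))"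
proof (induction n)
  case 0
  {
    case 1 show ?case by (simp add: circle_fun_const)
  next
    case 2 show ?case by (simp add: L1_lipschitz_const)
  }
next
  case (Suc n)
  have c: "circle_fun (\<lambda>x. f (Q n * x))"
    using circle_fun_shift[OF f(1), of "Q n" 0] by simp
  have l: "L1_lipschitz (Q n * V) (\<lambda>x. f (Q n * x))"
    using L1_lipschitz_dilate[OF f Q_pos[of n], of 0] by simp
  {
    case 1 show ?case
      using circle_fun_add[OF Suc.IH(1) c] by simp
  next
    case 2 show ?case
      using L1_lipschitz_add[OF Suc.IH c l] by (simp add: algebra_simps)
  }
qed

text \<open>
  The diagonal terms contribute at most \<open>1\<close> each, and mixing bounds the covariance of the
  \<open>n\<close>-th term with the sum of all earlier ones.
\<close>

lemma second_moment_sum_dilates: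
  fixes f :: "real \<Rightarrow> real"
  assumes f: "circle_fun f" "L1_lipschitz 2 f" "\<And>x. \<bar>f x\<bar> \<le> 1"
    and mean: "(\<integral>x. f x \<partial>circle_measure) = 0"
  shows "(\<integral>x. (\<Sum>k<n. f (Q k * x))\<^sup>2 \<partial>circle_measure) \<le> 5 * real n"
proof (induction n)
  case (Suc n)
  let ?S = "\<lambda>x::real. \<Sum>k<n. f (Q k * x)" and ?g = "\<lambda>x::real. f (Q n * x)"
  have S: "circle_fun ?S" "L1_lipschitz (2 * real (\<Sum>k<n. Q k)) ?S"
    using L1_lipschitz_sum_dilates[OF f(1,2)] by blast+
  have g: "circle_fun ?g" using circle_fun_shift[OF f(1), of "Q n" 0] by simp
  have int: "integrable circle_measure (\<lambda>x. (?S x)\<^sup>2)" "integrable circle_measure (\<lambda>x. ?S x * ?g x)"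
    "integrable circle_measure (\<lambda>x. (?g x)\<^sup>2)"
    unfolding power2_eq_square by (intro integrable_circle_fun circle_fun_mult S(1) g)+
  have "norm (\<integral>x. ?S x * f (of_nat (Q n) * x + 0) \<partial>circle_measure) \<le> 1 * (2 * real (\<Sum>k<n. Q k)) / of_nat (Q n)"
    by (rule mixing[OF f(1) _ mean S Q_pos]) (simp add: f(3))
  then have "\<bar>\<integral>x. ?S x * ?g x \<partial>circle_measure\<bar> \<le> 2 * (real (\<Sum>k<n. Q k) / Q n)"
    by simp
  also have "\<dots> \<le> 2 * (1 / 2) ^ n"
    using gap_ratio[of n] by (intro mult_left_mono) auto
  also have "\<dots> \<le> 2" by (simp add: power_le_one)
  finally have cross: "\<bar>\<integral>x. ?S x * ?g x \<partial>circle_measure\<bar> \<le> 2" .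
  have "(?g x)\<^sup>2 \<le> 1" for x
    using f(3)[of "Q n * x"] by (simp add: abs_square_le_1)
  then have "(\<integral>x. (?g x)\<^sup>2 \<partial>circle_measure) \<le> (\<integral>x. 1 \<partial>circle_measure)"
    using int by (intro integral_mono) auto
  then have sq: "(\<integral>x. (?g x)\<^sup>2 \<partial>circle_measure) \<le> 1"
    using circle.prob_space by simp
  have "(\<Sum>k<Suc n. f (Q k * x))\<^sup>2 = (?S x)\<^sup>2 + 2 * (?S x * ?g x) + (?g x)\<^sup>2" for x :: real
    by (simp add: power2_eq_square algebra_simps)
  then have "(\<integral>x. (\<Sum>k<Suc n. f (Q k * x))\<^sup>2 \<partial>circle_measure) =
      (\<integral>x. (?S x)\<^sup>2 \<partial>circle_measure) + 2 * (\<integral>x. ?S x * ?g x \<partial>circle_measure)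
        + (\<integral>x. (?g x)\<^sup>2 \<partial>circle_measure)"
    using int by simp
  then show ?case using Suc.IH cross sq by simp
qed simp

lemma AE_average_variance:
  "AE \<beta> in circle_measure.
    (\<lambda>n. (\<Sum>k<n. frac (Q k * \<beta>) * (1 - frac (Q k * \<beta>))) / n) \<longlonglongrightarrow> 1 / 6"
proof -
  have "AE \<beta> in circle_measure. (\<lambda>n. (\<Sum>k<n. centred_variance (Q k * \<beta>)) / n) \<longlonglongrightarrow> 0"
  proof (rule circle.averages_tend_to_0[where K = 5])
    show "(\<lambda>x. centred_variance (Q k * x)) \<in> borel_measurable circle_measure" for k
      using circle_fun_measurable[OF circle_fun_shift[OF circle_fun_centred_variance, of "Q k" 0]]
      by (simp add: measurable_circle)
    show "(\<integral>x. (\<Sum>k<n. centred_variance (Q k * x))\<^sup>2 \<partial>circle_measure) \<le> 5 * real n" for n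
      by (rule second_moment_sum_dilates[OF circle_fun_centred_variance L1_lipschitz_centred_variance
            abs_centred_variance_le integral_centred_variance])
  qed (rule abs_centred_variance_le)
  then show ?thesis
  proof (rule AE_mp, intro AE_I2 impI)
    fix \<beta> :: real assume lim: "(\<lambda>n. (\<Sum>k<n. centred_variance (Q k * \<beta>)) / n) \<longlonglongrightarrow> 0"
    have "(\<lambda>n. (\<Sum>k<n. centred_variance (Q k * \<beta>)) / n + 1 / 6) \<longlonglongrightarrow> 0 + 1 / 6"
      by (intro tendsto_add lim tendsto_const)
    moreover have "\<forall>\<^sub>F n in sequentially. (\<Sum>k<n. centred_variance (Q k * \<beta>)) / n + 1 / 6 =
        (\<Sum>k<n. frac (Q k * \<beta>) * (1 - frac (Q k * \<beta>))) / n"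
      using eventually_gt_at_top[of 0]
      by eventually_elim (simp add: centred_variance_def sum_subtractf diff_divide_distrib)
    ultimately show "(\<lambda>n. (\<Sum>k<n. frac (Q k * \<beta>) * (1 - frac (Q k * \<beta>))) / n) \<longlonglongrightarrow> 1 / 6"
      using tendsto_cong by fastforce
  qed
qed

end

section \<open>Characteristic functions of sums of dilates\<close>

lemma cmod_iexp_diff_le: "cmod (iexp x - iexp y) \<le> \<bar>x - y\<bar>"
proof -
  have "iexp x - iexp y = iexp y * (iexp (x - y) - 1)"
    by (simp add: algebra_simps flip: exp_add)
  then have "cmod (iexp x - iexp y) = cmod (iexp (x - y) - 1)"
    by (simp add: norm_mult)
  also have "\<dots> \<le> \<bar>x - y\<bar>"
    using iexp_approx1[of "x - y" 0] by simp
  finally show ?thesis .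
qed

context
  fixes b \<theta> :: real
  assumes b: "0 \<le> b" "b < 1"
begin

lemma circle_fun_iexp_centred: "circle_fun (\<lambda>y. iexp (\<theta> * centred_indicator b y))"
proof (rule circle_funI[of _ 1])
  show "iexp (\<theta> * centred_indicator b (x + 1)) = iexp (\<theta> * centred_indicator b x)" for x
    using circle_fun_add_one[OF circle_fun_centred_indicator[OF b]] by simp
qed (auto intro!: borel_measurable_continuous_on[of exp] continuous_intros)

lemma L1_lipschitz_iexp_centred:
  "L1_lipschitz (\<bar>\<theta>\<bar> * 2) (\<lambda>y. iexp (\<theta> * centred_indicator b y))"
  unfolding L1_lipschitz_def
proof
  fix h
  let ?c = "centred_indicator b"
  have "(\<integral>x. norm (iexp (\<theta> * ?c (x + h)) - iexp (\<theta> * ?c x)) \<partial>circle_measure) \<le>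
      (\<integral>x. \<bar>\<theta>\<bar> * norm (?c (x + h) - ?c x) \<partial>circle_measure)"
  proof (rule integral_mono')
    show "integrable circle_measure (\<lambda>x. \<bar>\<theta>\<bar> * norm (?c (x + h) - ?c x))"
      by (intro integrable_mult_right integrable_circle_increment circle_fun_centred_indicator b)
    show "norm (iexp (\<theta> * ?c (x + h)) - iexp (\<theta> * ?c x)) \<le> \<bar>\<theta>\<bar> * norm (?c (x + h) - ?c x)" for x
      using cmod_iexp_diff_le[of "\<theta> * ?c (x + h)" "\<theta> * ?c x"]
      by (simp add: right_diff_distrib[symmetric] abs_mult del: of_real_mult)
  qed simp
  also have "\<dots> \<le> \<bar>\<theta>\<bar> * (2 * \<bar>h\<bar>)"
    using L1_lipschitz_centred_indicator[OF b] unfolding L1_lipschitz_def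
    by (simp add: mult_left_mono)
  finally show "(\<integral>x. norm (iexp (\<theta> * ?c (x + h)) - iexp (\<theta> * ?c x)) \<partial>circle_measure) \<le>
      \<bar>\<theta>\<bar> * 2 * \<bar>h\<bar>"
    by simp
qed

text \<open>
  The second-order expansion of a characteristic function, with the quadratic polynomial replaced
  by the Gaussian factor of the same variance: such factors multiply exactly, so only the sum of
  the variances enters the limit.
\<close>

lemma char_centred_indicator_approx:
  "cmod ((\<integral>y. iexp (\<theta> * centred_indicator b y) \<partial>circle_measure) - exp (- \<theta>\<^sup>2 / 2 * (b * (1 - b))))
    \<le> \<bar>\<theta>\<bar> ^ 3 + \<theta> ^ 4"
proof -
  let ?c = "centred_indicator b" and ?v = "b * (1 - b)"
  define m where "m = (\<integral>y. iexp (\<theta> * ?c y) \<partial>circle_measure)"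
  have c: "circle_fun ?c" by (rule circle_fun_centred_indicator[OF b])
  have int: "integrable circle_measure ?c" "integrable circle_measure (\<lambda>x. (?c x)\<^sup>2)"
    unfolding power2_eq_square by (intro integrable_circle_fun circle_fun_mult c)+
  have "cmod (char (distr circle_measure borel ?c) \<theta> - (1 - \<theta>\<^sup>2 * ?v / 2)) \<le>
      (\<theta>\<^sup>2 / 6) * (\<integral>x. min (6 * (?c x)\<^sup>2) (\<bar>\<theta>\<bar> * \<bar>?c x\<bar> ^ 3) \<partial>circle_measure)"
  proof (rule circle.char_approx3'[OF _ int integral_centred_indicator[OF b] _ refl])
    show "(\<integral>x. (?c x - circle.expectation ?c)\<^sup>2 \<partial>circle_measure) = ?v"
      unfolding integral_centred_indicator[OF b] using integral_centred_indicator_square[OF b] by simp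
  qed (simp add: measurable_circle)
  also have "char (distr circle_measure borel ?c) \<theta> = m"
    unfolding m_def char_def
    by (subst integral_distr)
       (auto intro!: measurable_circle borel_measurable_continuous_on[of exp] continuous_intros)
  also have "(\<integral>x. min (6 * (?c x)\<^sup>2) (\<bar>\<theta>\<bar> * \<bar>?c x\<bar> ^ 3) \<partial>circle_measure) \<le> (\<integral>x. \<bar>\<theta>\<bar> \<partial>circle_measure)"
  proof (rule integral_mono')
    fix x
    have "\<bar>?c x\<bar> ^ 3 \<le> 1" using abs_centred_indicator_le[OF b] by (intro power_le_one) auto
    then have "\<bar>\<theta>\<bar> * \<bar>?c x\<bar> ^ 3 \<le> \<bar>\<theta>\<bar> * 1" by (intro mult_left_mono) auto
    then show "min (6 * (?c x)\<^sup>2) (\<bar>\<theta>\<bar> * \<bar>?c x\<bar> ^ 3) \<le> \<bar>\<theta>\<bar>" by simp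
  qed auto
  finally have "cmod (m - (1 - \<theta>\<^sup>2 * ?v / 2)) \<le> \<theta>\<^sup>2 / 6 * \<bar>\<theta>\<bar>"
    using circle.prob_space by (simp add: mult_left_mono)
  also have "\<dots> = \<bar>\<theta>\<bar> ^ 3 / 6" by (simp add: power3_eq_cube power2_eq_square)
  also have "\<dots> \<le> \<bar>\<theta>\<bar> ^ 3" by simp
  finally have 1: "cmod (m - complex_of_real (1 - \<theta>\<^sup>2 * ?v / 2)) \<le> \<bar>\<theta>\<bar> ^ 3" by simp
  define u where "u = \<theta>\<^sup>2 * ?v / 2"
  have v: "0 \<le> ?v" "?v \<le> 1 * 1" using b by (intro mult_nonneg_nonneg mult_mono; simp)+
  have "\<theta>\<^sup>2 * ?v \<le> \<theta>\<^sup>2" "0 \<le> \<theta>\<^sup>2 * ?v"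
    using v by (auto intro: mult_left_le)
  then have u: "0 \<le> u" "u \<le> \<theta>\<^sup>2" unfolding u_def by linarith+
  have "1 - u \<le> exp (- u)" using exp_ge_add_one_self[of "-u"] by simp
  moreover have "exp (- u) \<le> 1 - u + u\<^sup>2"
  proof (cases "u \<le> 1")
    case True
    have "1 \<le> (1 - u + u\<^sup>2) * (1 + u)"
    proof -
      have "(1 - u + u\<^sup>2) * (1 + u) = 1 + u ^ 3" by (simp add: algebra_simps power2_eq_square power3_eq_cube)
      then show ?thesis using u by simp
    qed
    also have "\<dots> \<le> (1 - u + u\<^sup>2) * exp u"
      using exp_ge_add_one_self[of u] True by (intro mult_left_mono) auto
    finally show ?thesis by (simp add: exp_minus field_simps)
  next
    case False
    then have "u \<le> u\<^sup>2" by (simp add: power2_eq_square)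
    moreover have "exp (-u) \<le> 1" using u by simp
    ultimately show ?thesis by linarith
  qed
  ultimately have "\<bar>(1 - u) - exp (- u)\<bar> \<le> u\<^sup>2" by simp
  also have "\<dots> \<le> (\<theta>\<^sup>2)\<^sup>2" using u by (intro power_mono) auto
  finally have 2: "cmod (complex_of_real (1 - u) - complex_of_real (exp (-u))) \<le> \<theta> ^ 4"
    by (simp flip: of_real_diff)
  have "cmod (m - complex_of_real (exp (-u))) \<le> \<bar>\<theta>\<bar> ^ 3 + \<theta> ^ 4"
    by (rule norm_diff_triangle_le[OF 1[folded u_def] 2])
  then show ?thesis unfolding m_def u_def by simp
qed

end

lemma sum_half_powers_le: "(\<Sum>k<n. (1 / 2 :: real) ^ k) \<le> 2"
proof -
  have "(\<Sum>k<n. (1 / 2 :: real) ^ k) = 2 - 2 * (1 / 2) ^ n"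
    by (induction n) auto
  then show ?thesis by simp
qed

lemma sum_blocks:
  fixes h :: "nat \<Rightarrow> 'a::comm_monoid_add" and Q :: "nat \<Rightarrow> nat"
  shows "(\<Sum>j=1..(\<Sum>k<N. Q k). h j) = (\<Sum>k<N. \<Sum>i=1..Q k. h ((\<Sum>l<k. Q l) + i))"
proof (induction N)
  case (Suc N)
  let ?L = "\<Sum>k<N. Q k"
  have "(\<Sum>j=1..(\<Sum>k<Suc N. Q k). h j) = (\<Sum>j=1..?L. h j) + (\<Sum>j=1+?L..Q N+?L. h j)"
    using sum.ub_add_nat[of 1 ?L h "Q N"] by (simp add: add.commute)
  also have "(\<Sum>j=1+?L..Q N+?L. h j) = (\<Sum>i=1..Q N. h (?L + i))"
    by (subst sum.shift_bounds_cl_nat_ivl) (simp add: add.commute)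
  finally show ?case using Suc.IH by simp
qed simp

context lacunary
begin

context
  fixes b c :: "nat \<Rightarrow> real" and \<theta> :: real
  assumes b: "\<And>k. 0 \<le> b k" "\<And>k. b k < 1"
begin

text \<open>
  The factors are exchanged for their means one at a time, starting from the fastest: mixing
  applies with the product of the slower factors as \<open>G\<close>. Since the modulus of that product is
  proportional to \<open>\<bar>\<theta>\<bar>\<close>, the total error tends to \<open>0\<close> with \<open>\<theta>\<close> whatever the number of factors.
\<close>

lemma product_of_dilates:
  defines "P \<equiv> \<lambda>n (x::real). \<Prod>k<n. iexp (\<theta> * centred_indicator (b k) (Q k * x + c k))"
  shows "circle_fun (P n)" and "L1_lipschitz (\<bar>\<theta>\<bar> * 2 * real (\<Sum>k<n. Q k)) (P n)"
    and "cmod ((\<integral>x. P n x \<partial>circle_measure) -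
      (\<Prod>k<n. \<integral>y. iexp (\<theta> * centred_indicator (b k) y) \<partial>circle_measure)) \<le>
      4 * \<bar>\<theta>\<bar> * (\<Sum>k<n. (1 / 2) ^ k)"
proof (induction n)
  case 0
  {
    case 1 show ?case by (simp add: P_def circle_fun_const)
  next
    case 2 show ?case by (simp add: P_def L1_lipschitz_const)
  next
    case 3 show ?case using circle.prob_space by (simp add: P_def)
  }
next
  case (Suc n)
  define f where "f = (\<lambda>y. iexp (\<theta> * centred_indicator (b n) y))"
  let ?g = "\<lambda>x. f (real (Q n) * x + c n)"
  define m where "m = (\<integral>y. f y \<partial>circle_measure)"
  define M where "M = (\<Prod>k<n. \<integral>y. iexp (\<theta> * centred_indicator (b k) y) \<partial>circle_measure)"
  have f: "circle_fun f" "L1_lipschitz (\<bar>\<theta>\<bar> * 2) f" "\<And>x. norm (f x) \<le> 1"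
    unfolding f_def using circle_fun_iexp_centred[OF b] L1_lipschitz_iexp_centred[OF b]
    by (auto simp del: of_real_mult)
  have g: "circle_fun ?g" "L1_lipschitz (Q n * (\<bar>\<theta>\<bar> * 2)) ?g"
    by (rule circle_fun_shift[OF f(1)] L1_lipschitz_dilate[OF f(1,2) Q_pos])+
  have P_norm: "norm (P n x) \<le> 1" for x
    unfolding P_def prod_norm[symmetric] by (simp del: of_real_mult)
  have P_Suc: "P (Suc n) = (\<lambda>x. P n x * ?g x)" unfolding P_def f_def by (simp add: fun_eq_iff)
  {
    case 1 show ?case unfolding P_Suc by (rule circle_fun_mult[OF Suc.IH(1) g(1)])
  next
    case 2 show ?case
      using L1_lipschitz_mult[OF Suc.IH(1,2) P_norm g f(3)] unfolding P_Suc
      by (simp add: algebra_simps)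
  next
    case 3
    have m: "norm m \<le> 1"
      using norm_integral_circle_le[OF f(3) integrable_circle_fun[OF f(1)], of] circle.prob_space
      unfolding m_def by simp
    have f': "circle_fun (\<lambda>y. f y - m)"
      using circle_fun_add[OF f(1) circle_fun_const[of "-m"]] by simp
    have "norm (\<integral>x. P n x * (f (of_nat (Q n) * x + c n) - m) \<partial>circle_measure)
        \<le> 2 * (\<bar>\<theta>\<bar> * 2 * real (\<Sum>k<n. Q k)) / of_nat (Q n)"
    proof (rule mixing[OF f' _ _ Suc.IH(1,2) Q_pos])
      show "norm (f x - m) \<le> 2" for x
        using norm_triangle_ineq4[of "f x" m] f(3)[of x] m by simp
      show "(\<integral>x. f x - m \<partial>circle_measure) = 0"
        using integrable_circle_fun[OF f(1)] circle.prob_space unfolding m_def by simp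
    qed
    also have "\<dots> = 4 * \<bar>\<theta>\<bar> * (real (\<Sum>k<n. Q k) / Q n)" by simp
    also have "\<dots> \<le> 4 * \<bar>\<theta>\<bar> * (1 / 2) ^ n"
      by (intro mult_left_mono gap_ratio) auto
    finally have mix: "norm (\<integral>x. P n x * (?g x - m) \<partial>circle_measure) \<le> 4 * \<bar>\<theta>\<bar> * (1 / 2) ^ n" .
    have int: "integrable circle_measure (P n)" "integrable circle_measure (\<lambda>x. P n x * ?g x)"
      by (intro integrable_circle_fun circle_fun_mult Suc.IH(1) g(1))+
    have "(\<integral>x. P n x * ?g x \<partial>circle_measure) - M * m =
        (\<integral>x. P n x * (?g x - m) \<partial>circle_measure) + ((\<integral>x. P n x \<partial>circle_measure) - M) * m"
      using int by (simp add: algebra_simps)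
    also have "norm \<dots> \<le> 4 * \<bar>\<theta>\<bar> * (1 / 2) ^ n + 4 * \<bar>\<theta>\<bar> * (\<Sum>k<n. (1 / 2) ^ k) * 1"
    proof (intro order_trans[OF norm_triangle_ineq] add_mono mix)
      show "norm (((\<integral>x. P n x \<partial>circle_measure) - M) * m) \<le> 4 * \<bar>\<theta>\<bar> * (\<Sum>k<n. (1 / 2) ^ k) * 1"
        unfolding norm_mult using Suc.IH(3) m
        by (intro mult_mono) (auto simp: M_def intro!: mult_nonneg_nonneg sum_nonneg)
    qed
    finally show ?case
      unfolding P_Suc by (simp add: M_def m_def f_def distrib_left)
  }
qed

lemma char_sum_of_dilates:
  "cmod ((\<integral>x. iexp (\<theta> * (\<Sum>k<n. centred_indicator (b k) (Q k * x + c k))) \<partial>circle_measure) -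
      exp (- \<theta>\<^sup>2 / 2 * (\<Sum>k<n. b k * (1 - b k)))) \<le>
    8 * \<bar>\<theta>\<bar> + n * (\<bar>\<theta>\<bar> ^ 3 + \<theta> ^ 4)"
proof -
  define m where "m k = (\<integral>y. iexp (\<theta> * centred_indicator (b k) y) \<partial>circle_measure)" for k
  define w where "w k = complex_of_real (exp (- \<theta>\<^sup>2 / 2 * (b k * (1 - b k))))" for k
  let ?P = "\<integral>x. (\<Prod>k<n. iexp (\<theta> * centred_indicator (b k) (Q k * x + c k))) \<partial>circle_measure"
  have "iexp (\<theta> * (\<Sum>k<n. centred_indicator (b k) (Q k * x + c k))) =
      (\<Prod>k<n. iexp (\<theta> * centred_indicator (b k) (Q k * x + c k)))" for x :: real
    unfolding sum_distrib_left of_real_sum by (rule exp_sum) simp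
  then have P: "(\<integral>x. iexp (\<theta> * (\<Sum>k<n. centred_indicator (b k) (Q k * x + c k))) \<partial>circle_measure) = ?P"
    by simp
  have W: "complex_of_real (exp (- \<theta>\<^sup>2 / 2 * (\<Sum>k<n. b k * (1 - b k)))) = (\<Prod>k<n. w k)"
    unfolding w_def by (simp add: sum_distrib_left exp_sum flip: of_real_prod)
  have "cmod (?P - (\<Prod>k<n. m k)) \<le> 4 * \<bar>\<theta>\<bar> * (\<Sum>k<n. (1 / 2) ^ k)"
    unfolding m_def by (rule product_of_dilates(3))
  also have "\<dots> \<le> 4 * \<bar>\<theta>\<bar> * 2"
    by (intro mult_left_mono sum_half_powers_le) auto
  finally have 1: "cmod (?P - (\<Prod>k<n. m k)) \<le> 8 * \<bar>\<theta>\<bar>" by simp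
  have "cmod ((\<Prod>k<n. m k) - (\<Prod>k<n. w k)) \<le> (\<Sum>k<n. cmod (m k - w k))"
  proof (rule norm_prod_diff)
    fix k
    show "cmod (m k) \<le> 1"
    proof -
      have "cmod (m k) \<le> (\<integral>y. 1 \<partial>circle_measure)"
        unfolding m_def
        by (intro norm_integral_circle_le integrable_circle_fun circle_fun_iexp_centred b circle_fun_const)
           (auto simp del: of_real_mult)
      then show ?thesis using circle.prob_space by simp
    qed
    have "0 \<le> b k * (1 - b k)" using b[of k] by (intro mult_nonneg_nonneg) auto
    then show "cmod (w k) \<le> 1" unfolding w_def by (simp del: of_real_exp)
  qed
  also have "\<dots> \<le> (\<Sum>k<n. \<bar>\<theta>\<bar> ^ 3 + \<theta> ^ 4)"
    unfolding m_def w_def by (intro sum_mono char_centred_indicator_approx b)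
  finally have 2: "cmod ((\<Prod>k<n. m k) - (\<Prod>k<n. w k)) \<le> n * (\<bar>\<theta>\<bar> ^ 3 + \<theta> ^ 4)" by simp
  show ?thesis
    unfolding P W by (rule norm_diff_triangle_le[OF 1 2])
qed

end

section \<open>The central limit theorem along the blocks\<close>

text \<open>
  By the block approximation the Birkhoff sum differs from a sum of dilates by at most \<open>4\<close> in mean,
  which the normalisation makes negligible, so the characteristic functions of the two have the
  same limit.
\<close>

theorem central_limit_blocks:
  fixes \<alpha> \<beta> :: real and p :: "nat \<Rightarrow> int"
  assumes p: "\<And>k. coprime (p k) (int (Q k))"
    and approx: "\<And>k. 2 ^ k * (Q k * \<bar>Q k * \<alpha> - p k\<bar>) \<le> 1"
    and \<beta>: "0 \<le> \<beta>" "\<beta> < 1"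
    and variance: "(\<lambda>n. (\<Sum>k<n. frac (Q k * \<beta>) * (1 - frac (Q k * \<beta>))) / n) \<longlonglongrightarrow> 1 / 6"
  shows "weak_conv_m
      (\<lambda>N. distr circle_measure borel
        (\<lambda>x. sqrt 6 / sqrt (real N) *
          (\<Sum>j = 1..(\<Sum>k<N. Q k). centred_indicator \<beta> (x + real j * \<alpha>))))
      std_normal_distribution"
proof (rule levy_continuity)
  define A where "A N x = (\<Sum>j = 1..(\<Sum>k<N. Q k). centred_indicator \<beta> (x + real j * \<alpha>))" for N x
  define b where "b k = frac (Q k * \<beta>)" for k
  \<comment> \<open>The phase accumulated before the \<open>k\<close>-th block starts; the estimates are uniform in it.\<close>
  define c where "c k = Q k * (real (\<Sum>l<k. Q l) * \<alpha>)" for k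
  define X where "X N x = (\<Sum>k<N. centred_indicator (b k) (Q k * x + c k))" for N and x :: real
  define v where "v n = (\<Sum>k<n. b k * (1 - b k))" for n
  have b: "0 \<le> b k" "b k < 1" for k unfolding b_def by (auto simp: frac_lt_1)
  have A_meas [measurable]: "A N \<in> borel_measurable borel" for N
    unfolding A_def by (intro borel_measurable_sum borel_measurable_centred_indicator) measurable
  have X_meas [measurable]: "X N \<in> borel_measurable borel" for N
    unfolding X_def by (intro borel_measurable_sum borel_measurable_centred_indicator) measurable
  have meas: "(\<lambda>x. sqrt 6 / sqrt (real N) * A N x) \<in> borel_measurable circle_measure" for N
    by (intro measurable_circle) measurable
  show "real_distribution (distr circle_measure borel (\<lambda>x. sqrt 6 / sqrt (real N) *
      (\<Sum>j = 1..(\<Sum>k<N. Q k). centred_indicator \<beta> (x + real j * \<alpha>))))" for N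
    using circle.real_distribution_distr[OF meas[of N]] unfolding A_def .
  show "real_distribution std_normal_distribution"
    by (rule real_dist_normal_dist)
  have int_c: "integrable circle_measure (\<lambda>x. centred_indicator d (q * x + y))"
    if "0 \<le> d" "d < 1" for d y and q :: nat
    by (intro integrable_circle_fun circle_fun_shift circle_fun_centred_indicator that)
  have int_A: "integrable circle_measure (A N)" for N
    unfolding A_def using int_c[OF \<beta>, of 1] by (intro Bochner_Integration.integrable_sum) simp
  have int_X: "integrable circle_measure (X N)" for N
    unfolding X_def by (intro Bochner_Integration.integrable_sum int_c b)
  have L1: "(\<integral>x. \<bar>A N x - X N x\<bar> \<partial>circle_measure) \<le> 4" for N
  proof -
    let ?D = "\<lambda>(k::nat) (x::real). (\<Sum>i=1..Q k. centred_indicator \<beta> (x + real (\<Sum>l<k. Q l) * \<alpha> + i * \<alpha>)) -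
      centred_indicator (b k) (Q k * x + c k)"
    have int_D: "integrable circle_measure (\<lambda>x. \<bar>?D k x\<bar>)" for k
      using int_c[OF \<beta>, of 1] int_c[OF b]
      by (intro integrable_abs Bochner_Integration.integrable_diff Bochner_Integration.integrable_sum)
         (simp_all add: add.assoc)
    have "A N x - X N x = (\<Sum>k<N. ?D k x)" for x
      unfolding A_def X_def sum_blocks sum_subtractf by (simp add: distrib_right add.assoc)
    then have "(\<integral>x. \<bar>A N x - X N x\<bar> \<partial>circle_measure) \<le> (\<integral>x. (\<Sum>k<N. \<bar>?D k x\<bar>) \<partial>circle_measure)"
      using int_D by (intro integral_mono') (auto intro!: Bochner_Integration.integrable_sum)
    also have "\<dots> = (\<Sum>k<N. \<integral>x. \<bar>?D k x\<bar> \<partial>circle_measure)"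
      by (intro Bochner_Integration.integral_sum int_D)
    also have "\<dots> \<le> (\<Sum>k<N. 2 * (1 / 2) ^ k)"
    proof (rule sum_mono)
      fix k
      have "(\<integral>x. \<bar>?D k x\<bar> \<partial>circle_measure) \<le> 2 * (Q k * \<bar>Q k * \<alpha> - p k\<bar>)"
        unfolding b_def c_def
        using L1_block_approximation[OF Q_pos[of k] p[of k] \<beta>, of "real (\<Sum>l<k. Q l) * \<alpha>" \<alpha>] .
      also have "\<dots> \<le> 2 * (1 / 2) ^ k"
        using approx[of k] by (simp add: field_simps)
      finally show "(\<integral>x. \<bar>?D k x\<bar> \<partial>circle_measure) \<le> 2 * (1 / 2) ^ k" .
    qed
    also have "\<dots> = 2 * (\<Sum>k<N. (1 / 2) ^ k)" by (simp add: sum_distrib_left)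
    also have "\<dots> \<le> 2 * 2" by (intro mult_left_mono sum_half_powers_le) auto
    finally show ?thesis by simp
  qed
  show "(\<lambda>N. char (distr circle_measure borel (\<lambda>x. sqrt 6 / sqrt (real N) *
      (\<Sum>j = 1..(\<Sum>k<N. Q k). centred_indicator \<beta> (x + real j * \<alpha>)))) s)
    \<longlonglongrightarrow> char std_normal_distribution s" for s
    unfolding A_def[symmetric]
  proof -
    define \<theta> where "\<theta> N = s * (sqrt 6 / sqrt (real N))" for N :: nat
    let ?char = "\<lambda>N. char (distr circle_measure borel (\<lambda>x. sqrt 6 / sqrt (real N) * A N x)) s"
    let ?gauss = "\<lambda>N. complex_of_real (exp (- (\<theta> N)\<^sup>2 / 2 * v N))"
    have iexp_meas: "(\<lambda>x. iexp (r * f x)) \<in> borel_measurable borel"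
      if "f \<in> borel_measurable borel" for r and f :: "real \<Rightarrow> real"
      using that by (intro borel_measurable_continuous_on[of exp] continuous_intros) measurable
    have int_iexp: "integrable circle_measure (\<lambda>x. iexp (r * f x))"
      if "f \<in> borel_measurable borel" for r and f :: "real \<Rightarrow> real"
      by (rule integrable_circle_bounded[OF iexp_meas[OF that], of _ 1]) (simp del: of_real_mult)
    have char_eq: "?char N = (\<integral>x. iexp (\<theta> N * A N x) \<partial>circle_measure)" for N
      unfolding char_def \<theta>_def
      by (subst integral_distr[OF meas]) (auto simp: mult_ac intro!: iexp_meas[where f = "\<lambda>x. x"])
    have diff: "cmod (?char N - (\<integral>x. iexp (\<theta> N * X N x) \<partial>circle_measure)) \<le> 4 * \<bar>\<theta> N\<bar>" for N
    proof -
      have "?char N - (\<integral>x. iexp (\<theta> N * X N x) \<partial>circle_measure) =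
          (\<integral>x. iexp (\<theta> N * A N x) - iexp (\<theta> N * X N x) \<partial>circle_measure)"
        unfolding char_eq using int_iexp[OF A_meas] int_iexp[OF X_meas]
        by (rule Bochner_Integration.integral_diff[symmetric])
      also have "cmod \<dots> \<le> (\<integral>x. \<bar>\<theta> N\<bar> * \<bar>A N x - X N x\<bar> \<partial>circle_measure)"
      proof (rule norm_integral_circle_le)
        show "cmod (iexp (\<theta> N * A N x) - iexp (\<theta> N * X N x)) \<le> \<bar>\<theta> N\<bar> * \<bar>A N x - X N x\<bar>" for x
          using cmod_iexp_diff_le[of "\<theta> N * A N x" "\<theta> N * X N x"]
          by (simp add: right_diff_distrib[symmetric] abs_mult del: of_real_mult)
      qed (intro Bochner_Integration.integrable_diff int_iexp A_meas X_meas integrable_mult_right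
            integrable_abs int_A int_X)+
      also have "\<dots> \<le> \<bar>\<theta> N\<bar> * 4"
        using L1[of N] by (simp add: mult_left_mono)
      finally show ?thesis by simp
    qed
    have total: "cmod (?char N - ?gauss N) \<le> (12 + 6 * s\<^sup>2) * \<bar>\<theta> N\<bar> + 6 * s\<^sup>2 * (\<theta> N)\<^sup>2" if "0 < N" for N
    proof -
      have "cmod ((\<integral>x. iexp (\<theta> N * X N x) \<partial>circle_measure) - ?gauss N) \<le>
          8 * \<bar>\<theta> N\<bar> + N * (\<bar>\<theta> N\<bar> ^ 3 + \<theta> N ^ 4)"
        unfolding X_def v_def by (rule char_sum_of_dilates[OF b])
      from norm_diff_triangle_le[OF diff this]
      have "cmod (?char N - ?gauss N) \<le> 12 * \<bar>\<theta> N\<bar> + N * (\<bar>\<theta> N\<bar> ^ 3 + \<theta> N ^ 4)" by simp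
      moreover have sq: "N * (\<theta> N)\<^sup>2 = 6 * s\<^sup>2"
        using that unfolding \<theta>_def by (simp add: power_mult_distrib power_divide)
      have "N * (\<bar>\<theta> N\<bar> ^ 3 + \<theta> N ^ 4) = N * (\<theta> N)\<^sup>2 * (\<bar>\<theta> N\<bar> + (\<theta> N)\<^sup>2)"
        by (simp add: power3_eq_cube power2_eq_square power4_eq_xxxx algebra_simps)
      ultimately show ?thesis unfolding sq by (simp add: algebra_simps)
    qed
    have "(\<lambda>N. s * (sqrt 6 / sqrt (real N))) \<longlonglongrightarrow> s * 0"
      by (intro tendsto_mult tendsto_const real_tendsto_divide_at_top[OF tendsto_const]
          filterlim_compose[OF sqrt_at_top filterlim_real_sequentially])
    then have \<theta>_lim: "\<theta> \<longlonglongrightarrow> 0" unfolding \<theta>_def by simp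
    have "(\<lambda>N. ?char N - ?gauss N) \<longlonglongrightarrow> 0"
    proof (rule Lim_null_comparison)
      show "\<forall>\<^sub>F N in sequentially. norm (?char N - ?gauss N) \<le>
          (12 + 6 * s\<^sup>2) * \<bar>\<theta> N\<bar> + 6 * s\<^sup>2 * (\<theta> N)\<^sup>2"
        using eventually_gt_at_top[of 0] by eventually_elim (rule total)
      show "(\<lambda>N. (12 + 6 * s\<^sup>2) * \<bar>\<theta> N\<bar> + 6 * s\<^sup>2 * (\<theta> N)\<^sup>2) \<longlonglongrightarrow> 0"
        using \<theta>_lim by (auto intro!: tendsto_eq_intros)
    qed
    moreover have "?gauss \<longlonglongrightarrow> complex_of_real (exp (- (s\<^sup>2 / 2)))"
    proof -
      have "(\<lambda>N. - 3 * s\<^sup>2 * (v N / N)) \<longlonglongrightarrow> - 3 * s\<^sup>2 * (1 / 6)"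
        using variance unfolding v_def b_def by (intro tendsto_mult tendsto_const)
      moreover have "\<forall>\<^sub>F N in sequentially. - 3 * s\<^sup>2 * (v N / N) = - (\<theta> N)\<^sup>2 / 2 * v N"
        using eventually_gt_at_top[of 0]
        by eventually_elim (simp add: \<theta>_def power_mult_distrib power_divide)
      ultimately have "(\<lambda>N. - (\<theta> N)\<^sup>2 / 2 * v N) \<longlonglongrightarrow> - (s\<^sup>2 / 2)"
        using tendsto_cong by fastforce
      then show ?thesis by (intro tendsto_of_real tendsto_exp)
    qed
    ultimately have "(\<lambda>N. (?char N - ?gauss N) + ?gauss N) \<longlonglongrightarrow> 0 + complex_of_real (exp (- (s\<^sup>2 / 2)))"
      by (rule tendsto_add)
    then show "?char \<longlonglongrightarrow> char std_normal_distribution s"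
      by (simp add: char_std_normal_distribution)
  qed
qed

end

section \<open>Choice of the subsequence\<close>

lemma unbounded_partial_quotients:
  assumes "\<not> bounded_type \<alpha>"
  shows "\<exists>n>m. C \<le> partial_quotient \<alpha> (Suc n)"
proof (rule ccontr)
  assume "\<not> (\<exists>n>m. C \<le> partial_quotient \<alpha> (Suc n))"
  then have small: "partial_quotient \<alpha> (Suc n) < C" if "m < n" for n
    using that not_le by blast
  have "partial_quotient \<alpha> n \<le> max C (Max (partial_quotient \<alpha> ` {..Suc m}))" for n
  proof (cases "n \<le> Suc m")
    case True
    then have "partial_quotient \<alpha> n \<le> Max (partial_quotient \<alpha> ` {..Suc m})"
      by (intro Max_ge) auto
    then show ?thesis by simp
  next
    case False
    then have "partial_quotient \<alpha> (Suc (n - 1)) < C" by (intro small) simp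
    then show ?thesis using False by simp
  qed
  then have "bounded_type \<alpha>" unfolding bounded_type_def by (intro bdd_aboveI2)
  then show False using assms by simp
qed

text \<open>
  Large partial quotients occur arbitrarily far out, so each index can be chosen after its predecessor
  with both a large next partial quotient and a large denominator. The factor \<open>k + 1\<close>
  in the condition on consecutive denominators accounts for the number of all earlier ones, so
  that the condition involves only the predecessor.
\<close>

lemma sparse_denominators:
  assumes irr: "\<alpha> \<notin> \<rat>" and unb: "\<not> bounded_type \<alpha>"
  obtains s :: "nat \<Rightarrow> nat" where "strict_mono s" "\<And>k. 0 < s k"
    "\<And>k. 2 ^ k \<le> partial_quotient \<alpha> (Suc (s k))" "lacunary (\<lambda>k. cf_denom \<alpha> (s k))"
proof -
  let ?q = "cf_denom \<alpha>"
  let ?P = "\<lambda>k x. 0 < x \<and> 2 ^ k \<le> partial_quotient \<alpha> (Suc x)"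
  let ?R = "\<lambda>k x y. x < y \<and> (k + 1) * ?q x * 2 ^ Suc k \<le> ?q y"
  have "\<exists>s. \<forall>k. ?P k (s k) \<and> ?R k (s k) (s (Suc k))"
  proof (rule dependent_nat_choice)
    show "\<exists>x. ?P 0 x"
      using partial_quotient_pos[OF irr, of 1] by (intro exI[of _ 1]) simp
    fix x k assume "?P k x"
    obtain y where y: "max x ((k + 1) * ?q x * 2 ^ Suc k) < y" "2 ^ Suc k \<le> partial_quotient \<alpha> (Suc y)"
      using unbounded_partial_quotients[OF unb] by blast
    then show "\<exists>y. ?P (Suc k) y \<and> ?R k x y"
      using cf_denom_ge_index[OF irr, of y] by (intro exI[of _ y]) auto
  qed
  then obtain s where s: "\<And>k. ?P k (s k)" "\<And>k. ?R k (s k) (s (Suc k))" by blast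
  have mono: "strict_mono s" using s(2) by (simp add: strict_mono_Suc_iff)
  have "lacunary (\<lambda>k. ?q (s k))"
  proof
    show "0 < ?q (s k)" for k using cf_denom_ge_1[OF irr, of "s k"] by simp
    show "(\<Sum>i<k. ?q (s i)) * 2 ^ k \<le> ?q (s k)" for k
    proof (cases k)
      case (Suc j)
      have "(\<Sum>i<k. ?q (s i)) \<le> of_nat (card {..<k}) * ?q (s j)"
      proof (rule sum_bounded_above)
        fix i assume "i \<in> {..<k}"
        then have "i \<le> j" using Suc by simp
        then show "?q (s i) \<le> ?q (s j)"
          by (rule monoD[OF cf_denom_mono[OF irr] monoD[OF strict_mono_mono[OF mono]]])
      qed
      then have "(\<Sum>i<k. ?q (s i)) \<le> (j + 1) * ?q (s j)" using Suc by simp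
      then have "(\<Sum>i<k. ?q (s i)) * 2 ^ k \<le> (j + 1) * ?q (s j) * 2 ^ k"
        by (rule mult_right_mono) simp
      also have "\<dots> = (j + 1) * ?q (s j) * 2 ^ Suc j" by (simp add: Suc)
      also have "\<dots> \<le> ?q (s k)" using s(2)[of j] Suc by blast
      finally show ?thesis .
    qed simp
  qed
  then show thesis using that[OF mono] s(1) by blast
qed

theorem mainTheorem5:
  fixes \<alpha> :: real
  assumes "0 < \<alpha>" and "\<alpha> < 1" and "\<alpha> \<notin> \<rat>" and "\<not> bounded_type \<alpha>"
  shows "\<exists>t :: nat \<Rightarrow> nat. strict_mono_on {1..} t \<and>
    (let L = (\<lambda>N. \<Sum>k = 1..N. cf_denom \<alpha> (t k)) in
      AE \<beta> in circle_measure.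
        weak_conv_m
          (\<lambda>N. distr circle_measure borel
            (\<lambda>x. sqrt 6 / sqrt (real N) *
              (\<Sum>j = 1..L N. centred_indicator \<beta> (x + real j * \<alpha>))))
          std_normal_distribution)"
proof -
  obtain s where s: "strict_mono s" "\<And>k. 0 < s k"
    "\<And>k. 2 ^ k \<le> partial_quotient \<alpha> (Suc (s k))" "lacunary (\<lambda>k. cf_denom \<alpha> (s k))"
    using sparse_denominators[OF assms(3,4)] by blast
  define Q where "Q k = cf_denom \<alpha> (s k)" for k
  interpret lacunary Q unfolding Q_def by (rule s(4))
  have "\<exists>p. coprime p (int (Q k)) \<and> 2 ^ k * (Q k * \<bar>Q k * \<alpha> - of_int p\<bar>) \<le> 1" for k
  proof -
    obtain n where n: "s k = Suc n" using s(2)[of k] gr0_implies_Suc by blast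
    obtain p where p: "coprime p (int (Q k))"
      "partial_quotient \<alpha> (Suc (s k)) * (Q k * \<bar>Q k * \<alpha> - of_int p\<bar>) \<le> 1"
      using convergent_approximation[OF assms(3,1,2), of n] unfolding Q_def n by metis
    have "(2::real) ^ k \<le> partial_quotient \<alpha> (Suc (s k))"
      using s(3)[of k] by (metis of_nat_le_iff of_nat_numeral of_nat_power)
    then have "2 ^ k * (Q k * \<bar>Q k * \<alpha> - of_int p\<bar>) \<le> 1"
      using p(2) by (meson abs_ge_zero mult_nonneg_nonneg mult_right_mono of_nat_0_le_iff order_trans)
    then show ?thesis using p(1) by blast
  qed
  then obtain p where p: "\<And>k. coprime (p k) (int (Q k))"
    "\<And>k. 2 ^ k * (Q k * \<bar>Q k * \<alpha> - of_int (p k)\<bar>) \<le> 1"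
    by metis
  define t where "t k = s (k - 1)" for k
  have t: "strict_mono_on {1..} t"
    unfolding t_def using s(1) by (auto intro!: strict_mono_onI simp: strict_mono_less)
  have L: "(\<Sum>k = 1..N. cf_denom \<alpha> (t k)) = (\<Sum>k<N. Q k)" for N
    unfolding t_def Q_def by (simp add: sum.atLeast1_atMost_eq)
  have "AE \<beta> in circle_measure. \<beta> \<in> space circle_measure" by (rule AE_space)
  with AE_average_variance have "AE \<beta> in circle_measure.
        weak_conv_m
          (\<lambda>N. distr circle_measure borel
            (\<lambda>x. sqrt 6 / sqrt (real N) *
              (\<Sum>j = 1..(\<Sum>k<N. Q k). centred_indicator \<beta> (x + real j * \<alpha>))))
          std_normal_distribution"
    by eventually_elim (rule central_limit_blocks[OF p], auto)
  then show ?thesis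
    using t unfolding L[symmetric] by (intro exI[of _ t]) (simp add: Let_def)
qed

end
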